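(* Let $\mathbf{L}_{\nu}$ denote the modified Struve function and $I_{\nu}$ the modified Bessel function of the first kind, with real order. The following assertions are true: (a) If $\nu\geq-\frac{1}{2}$, then the function $x\mapsto I_{\nu+1}(x)/\mathbf{L}_{\nu}(x)$ is increasing on $(0,\infty)$. (b) If $\nu\in\left(-\frac{3}{2},-\frac{1}{2}\right]$, then the function $x\mapsto I_{\nu+1}(x)/\mathbf{L}_{\nu}(x)$ is decreasing on $(0,\infty)$. (c) If $\mu\geq\nu>-\frac{3}{2}$, then the function $x\mapsto 2^{\nu-\mu}x^{\mu-\nu}\mathbf{L}_{\nu}(x)/\mathbf{L}_{\mu}(x)$ is increasing on $(0,\infty)$. (d) If $\nu\geq\mu>-\frac{3}{2}$, then the function $x\mapsto 2^{\nu-\mu}x^{\mu-\nu}\mathbf{L}_{\nu}(x)/\mathbf{L}_{\mu}(x)$ is decreasing on $(0,\infty)$. (e) For every $x>0$, the function $\nu\mapsto \mathcal{L}_{\nu}(x)=2^{\nu}\Gamma\left(\nu+\frac{3}{2}\right)x^{-\nu}\mathbf{L}_{\nu}(x)$ is decreasing and log-convex on $\left(-\frac{3}{2},\infty\right)$. (f) For every $x>0$, the function $\nu\mapsto \mathbf{L}_{\nu+1}(x)/\mathbf{L}_{\nu}(x)$ is decreasing on $\left(-\frac{3}{2},\infty\right)$. (g) For every $\nu>-\frac{3}{2}$, the function $x\mapsto x\mathbf{L}_{\nu}'(x)/\mathbf{L}_{\nu}(x)$ is increasing on $(0,\infty)$. (h) For every $\nu\geq-\frac{1}{2}$, the function $x\mapsto\frac{1}{\sqrt{\pi}}+2^{\nu}\Gamma\left(\nu+\frac{3}{2}\right)x^{-\nu}\mathbf{L}_{\nu+1}(x)$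 is log-convex on $(0,\infty)$. In particular, for all $x>0$ the following inequalities are valid: $\bullet$ $\displaystyle \mathbf{L}_{\nu}(x)<\frac{2\Gamma(\nu+2)}{\sqrt{\pi}\,\Gamma\left(\nu+\frac{3}{2}\right)}I_{\nu+1}(x)$ for $\nu>-\frac{1}{2}$; $\bullet$ $\displaystyle 2^{\nu}\Gamma\left(\nu+\tfrac{3}{2}\right)x^{-\nu}\mathbf{L}_{\nu}(x)>2^{\mu}\Gamma\left(\mu+\tfrac{3}{2}\right)x^{-\mu}\mathbf{L}_{\mu}(x)$ for $\mu>\nu>-\frac{3}{2}$; $\bullet$ $\displaystyle 0<\left[\mathbf{L}_{\nu}(x)\right]^2-\mathbf{L}_{\nu-1}(x)\mathbf{L}_{\nu+1}(x)<\frac{\left[\mathbf{L}_{\nu}(x)\right]^2}{\nu+\frac{3}{2}}$ for $\nu>-\frac{1}{2}$; $\bullet$ $\displaystyle \frac{\mathbf{L}_{\nu+1}(x)}{\mathbf{L}_{\nu}(x)}<\frac{\cosh x-1}{\sinh x}<1$ for $\nu>-\frac{1}{2}$; $\bullet$ $\displaystyle \left(1+\frac{\nu^2}{x^2}\right)\left[\mathbf{L}_{\nu}(x)\right]^2-\left[\mathbf{L}_{\nu}'(x)\right]^2+\frac{\left(\nu+\frac{1}{2}\right)x^{\nu-1}\mathbf{L}_{\nu}(x)}{\sqrt{\pi}\,2^{\nu-1}\Gamma\left(\nu+\frac{3}{2}\right)}>0$ for $\nu>-\frac{3}{2}$. Moreover, for all $x>0$: if $\nu\in\left(-\frac{3}{2},-\frac{1}{2}\right)$,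 then $$\mathbf{L}_{\nu}(x)>\frac{2\Gamma(\nu+2)}{\sqrt{\pi}\,\Gamma\left(\nu+\frac{3}{2}\right)}I_{\nu+1}(x)\qquad\text{and}\qquad \frac{\mathbf{L}_{\nu+1}(x)}{\mathbf{L}_{\nu}(x)}>\frac{\cosh x-1}{\sinh x};$$ if $\nu>\mu>-\frac{3}{2}$, then $$2^{\nu}\Gamma\left(\nu+\tfrac{3}{2}\right)x^{-\nu}\mathbf{L}_{\nu}(x)<2^{\mu}\Gamma\left(\mu+\tfrac{3}{2}\right)x^{-\mu}\mathbf{L}_{\mu}(x);$$ if $\nu=-\frac{1}{2}$, then equality holds: $$\mathbf{L}_{\nu}(x)=\frac{2\Gamma(\nu+2)}{\sqrt{\pi}\,\Gamma\left(\nu+\frac{3}{2}\right)}I_{\nu+1}(x)\qquad\text{and}\qquad \frac{\mathbf{L}_{\nu+1}(x)}{\mathbf{L}_{\nu}(x)}=\frac{\cosh x-1}{\sinh x};$$ and if $\mu=\nu$, then equality holds: $2^{\nu}\Gamma\left(\nu+\tfrac{3}{2}\right)x^{-\nu}\mathbf{L}_{\nu}(x)=2^{\mu}\Gamma\left(\mu+\tfrac{3}{2}\right)x^{-\mu}\mathbf{L}_{\mu}(x)$.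
   Context: For real $\nu$ and $x>0$, the modified Struve function $\mathbf{L}_{\nu}$ and the modified Bessel function of the first kind are given by the power series $$\mathbf{L}_{\nu}(x)=\sum_{n\geq0}\frac{\left(\frac{x}{2}\right)^{2n+\nu+1}}{\Gamma\left(n+\frac{3}{2}\right)\Gamma\left(n+\nu+\frac{3}{2}\right)},\qquad I_{\nu+1}(x)=\sum_{n\geq0}\frac{\left(\frac{x}{2}\right)^{2n+\nu+1}}{n!\,\Gamma(n+\nu+2)},$$ where $\Gamma$ is Euler's gamma function. A prime denotes differentiation with respect to $x$. A positive function $h$ on an interval is log-convex if $\log h$ is convex there. "Increasing" and "decreasing" are used in the weak sense (non-decreasing, non-increasing); for instance, the function $x\mapsto 2^{\nu-\mu}x^{\mu-\nu}\mathbf{L}_{\nu}(x)/\mathbf{L}_{\mu}(x)$ is constant when $\mu=\nu$. *)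

theory Defs
  imports "HOL-Analysis.Analysis"
begin

text \<open>
  Both series are meant for real order and \<open>x > 0\<close>; \<open>powr\<close> is the real power only on that domain.
  At the poles of \<^const>\<open>Gamma\<close> the library sets \<open>Gamma z = 0\<close>, hence \<open>1 / Gamma z = 0\<close>, which is
  the usual convention for the reciprocal gamma function.
\<close>

definition struve_L :: "real \<Rightarrow> real \<Rightarrow> real" where
  "struve_L \<nu> x =
     (\<Sum>n. (x / 2) powr (2 * real n + \<nu> + 1) / (Gamma (real n + 3 / 2) * Gamma (real n + \<nu> + 3 / 2)))"

definition bessel_I :: "real \<Rightarrow> real \<Rightarrow> real" where
  "bessel_I \<nu> x =
     (\<Sum>n. (x / 2) powr (2 * real n + \<nu>) / (fact n * Gamma (real n + \<nu> + 1)))"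

text \<open>Positivity is part of the notion, since \<open>ln\<close> is total.\<close>

definition log_convex_on :: "real set \<Rightarrow> (real \<Rightarrow> real) \<Rightarrow> bool" where
  "log_convex_on S h \<longleftrightarrow> (\<forall>x\<in>S. 0 < h x) \<and> convex_on S (\<lambda>x. ln (h x))"

end

theory Submission
  imports Defs
begin

text \<open>
  With \<open>G(p, q, t) = \<Sum>n. t\<^sup>n / (\<Gamma>(n + p) \<Gamma>(n + q))\<close> and \<open>t = (x/2)\<^sup>2\<close>, both \<open>L\<^sub>\<nu>\<close> and \<open>I\<^bsub>\<nu>+1\<^esub>\<close> are
  \<open>(x/2)\<^bsup>\<nu>+1\<^esup>\<close> times such a series, with \<open>(p, q) = (3/2, \<nu> + 3/2)\<close> and \<open>(1, \<nu> + 2)\<close> respectively.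
  A quotient of power series whose coefficient quotients are monotone is monotone, by Chebyshev's
  inequality; this gives (a)-(d) and (g). For (f), \<open>L\<^bsub>\<nu>+1\<^esub>/L\<^sub>\<nu>\<close> is, up to a constant and a factor
  independent of \<open>\<nu>\<close>, the mean of \<open>n\<close> under the weights \<open>t\<^sup>n / (\<Gamma>(n + 3/2) \<Gamma>(n + \<nu> + 3/2))\<close> minus
  the reciprocal of the normalized series; the mean decreases and the reciprocal increases in \<open>\<nu>\<close>.
  Part (e) holds
  because each \<open>\<Gamma>(q) / \<Gamma>(n + q)\<close> is log-convex in \<open>q\<close>, and (h) because the function there is a Beta
  average of \<open>x \<mapsto> cosh (x \<surd>u)\<close>. The last inequality is, by the differential equation of \<open>L\<^sub>\<nu>\<close>,
  the positivity of the variance of \<open>n\<close> under the same weights.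
\<close>

subsection \<open>Chebyshev's inequality for series\<close>

text \<open>Subtracting the weighted mean \<open>m\<close> of \<open>f\<close> makes the terms
  \<open>b n * (f n - m)\<close> sum to zero, so shifting \<open>g\<close> by a constant changes
  nothing. Shifting by the value of \<open>g\<close> where \<open>f\<close> first reaches
  \<open>m\<close> makes every product nonnegative.\<close>

lemma Chebyshev_suminf:
  fixes b f g :: "nat \<Rightarrow> real"
  assumes pos: "\<And>n. 0 < b n" and f: "incseq f" and g: "incseq g"
    and sb: "summable b" and sf: "summable (\<lambda>n. b n * f n)"
    and sg: "summable (\<lambda>n. b n * g n)" and sfg: "summable (\<lambda>n. b n * f n * g n)"
  shows "(\<Sum>n. b n * f n) * (\<Sum>n. b n * g n) \<le> (\<Sum>n. b n) * (\<Sum>n. b n * f n * g n)"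
proof -
  define m where "m = (\<Sum>n. b n * f n) / (\<Sum>n. b n)"
  have B: "0 < (\<Sum>n. b n)"
    using suminf_pos[OF sb] pos by blast
  have sm: "summable (\<lambda>n. b n * (f n - m))"
    using summable_diff[OF sf summable_mult2[OF sb, of m]] by (simp add: algebra_simps)
  have zero: "(\<Sum>n. b n * (f n - m)) = 0"
    using suminf_diff[OF sf summable_mult2[OF sb, of m]] suminf_mult2[OF sb, of m] B
    by (simp add: algebra_simps m_def)
  have "\<exists>n. m \<le> f n"
  proof (rule ccontr)
    assume "\<not> ?thesis"
    then have *: "f n < m" for n
      by (meson not_le)
    have "0 < (\<Sum>n. b n * (m - f n))"
      using summable_minus[OF sm] pos *
      by (intro suminf_pos) (auto simp: algebra_simps)
    moreover have "(\<Sum>n. b n * (m - f n)) = - (\<Sum>n. b n * (f n - m))"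
      using suminf_minus[OF sm] by (simp add: algebra_simps)
    ultimately show False
      using zero by simp
  qed
  define N where "N = (LEAST n. m \<le> f n)"
  have N: "m \<le> f N"
    unfolding N_def using \<open>\<exists>n. m \<le> f n\<close> by (rule LeastI_ex)
  \<comment> \<open>\<open>f - m\<close> changes sign at \<open>N\<close>, so it has the same sign as \<open>g - g N\<close>.\<close>
  have sign: "0 \<le> b n * (f n - m) * (g n - g N)" for n
  proof (cases "n < N")
    case True
    then have "f n - m \<le> 0" "g n - g N \<le> 0"
      using not_less_Least[of n "\<lambda>n. m \<le> f n"] g by (auto simp: N_def incseq_def)
    then show ?thesis
      using pos[of n] by (simp add: mult.assoc zero_le_mult_iff)
  next
    case False
    then have "0 \<le> f n - m" "0 \<le> g n - g N"
      using N f g by (auto simp: incseq_def not_less intro: order.trans)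
    then show ?thesis
      using pos[of n] by simp
  qed
  have eq: "b n * (f n - m) * (g n - g N) = b n * f n * g n - m * (b n * g n) - g N * (b n * (f n - m))" for n
    by (simp add: algebra_simps)
  have s1: "summable (\<lambda>n. b n * f n * g n - m * (b n * g n))"
    by (intro summable_diff summable_mult sfg sg)
  have "0 \<le> (\<Sum>n. b n * f n * g n - m * (b n * g n) - g N * (b n * (f n - m)))"
    using sign unfolding eq
    by (intro suminf_nonneg summable_diff s1 summable_mult sm) auto
  also have "\<dots> = (\<Sum>n. b n * f n * g n) - m * (\<Sum>n. b n * g n) - g N * (\<Sum>n. b n * (f n - m))"
    by (simp add: suminf_diff[symmetric] suminf_mult[symmetric] s1 summable_mult sfg sg sm)
  finally have "m * (\<Sum>n. b n * g n) \<le> (\<Sum>n. b n * f n * g n)"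
    using zero by simp
  then show ?thesis
    using B by (simp add: m_def field_simps)
qed

text \<open>Chebyshev's inequality with weights \<open>b n * s ^ n\<close> and the increasing
  sequences \<open>a n / b n\<close> and \<open>(t / s) ^ n\<close>; the second one moves the
  argument from \<open>s\<close> to \<open>t\<close>.\<close>

lemma powser_ratio_mono:
  fixes a b :: "nat \<Rightarrow> real"
  assumes pos: "\<And>n. 0 < b n" and inc: "incseq (\<lambda>n. a n / b n)"
    and a: "\<And>x. summable (\<lambda>n. a n * x ^ n)" and b: "\<And>x. summable (\<lambda>n. b n * x ^ n)"
    and s: "0 < s" and st: "s \<le> t"
  shows "(\<Sum>n. a n * s ^ n) * (\<Sum>n. b n * t ^ n) \<le> (\<Sum>n. a n * t ^ n) * (\<Sum>n. b n * s ^ n)"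
proof -
  have eq: "b n * s ^ n * (a n / b n) = a n * s ^ n"
    "b n * s ^ n * (t / s) ^ n = b n * t ^ n"
    "a n * s ^ n * (t / s) ^ n = a n * t ^ n" for n
    using pos[of n] s by (auto simp: power_divide)
  have "incseq (\<lambda>n. (t / s) ^ n)"
    using s st by (auto simp: incseq_def intro!: power_increasing)
  from Chebyshev_suminf[of "\<lambda>n. b n * s ^ n", OF _ inc this]
  show ?thesis
    using pos s a b by (simp only: eq) (simp add: algebra_simps)
qed

lemma powser_ratio_step:
  fixes a b :: "nat \<Rightarrow> real"
  assumes pos: "\<And>n. 0 < b n" and "\<And>n. a n * b (Suc n) \<le> a (Suc n) * b n"
  shows "incseq (\<lambda>n. a n / b n)"
  using assms by (intro incseq_SucI) (auto simp: field_simps)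

section \<open>The Euler operator \<open>x * d/dx\<close> on power series that converge
  everywhere\<close>

lemma summable_of_nat_mult:
  fixes c :: "nat \<Rightarrow> real"
  assumes "\<And>x. summable (\<lambda>n. c n * x ^ n)"
  shows "summable (\<lambda>n. real n * c n * x ^ n)"
proof -
  have "summable (\<lambda>n. diffs c n * x ^ n * x)"
    by (intro summable_mult2 termdiff_converges_all assms)
  then have "summable (\<lambda>n. real (Suc n) * c (Suc n) * x ^ Suc n)"
    by (simp add: diffs_def mult_ac)
  then show ?thesis
    using summable_Suc_iff[of "\<lambda>n. real n * c n * x ^ n"] by simp
qed

text \<open>The derivative is recorded through \<open>x * d\<close>, since this multiplies the
  \<open>n\<close>-th coefficient by \<open>n\<close> and keeps all exponents in place.\<close>

lemma DERIV_powser_mult: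
  fixes c :: "nat \<Rightarrow> real"
  assumes "\<And>x. summable (\<lambda>n. c n * x ^ n)"
  obtains d where "((\<lambda>x. \<Sum>n. c n * x ^ n) has_real_derivative d) (at x)"
    and "x * d = (\<Sum>n. real n * c n * x ^ n)"
proof
  show "((\<lambda>x. \<Sum>n. c n * x ^ n) has_real_derivative (\<Sum>n. diffs c n * x ^ n)) (at x)"
    by (rule termdiffs_strong_converges_everywhere[OF assms])
  have "(\<Sum>n. real (Suc n) * c (Suc n) * x ^ Suc n) = (\<Sum>n. real n * c n * x ^ n)"
    using suminf_split_head[OF summable_of_nat_mult[OF assms]] by simp
  then show "x * (\<Sum>n. diffs c n * x ^ n) = (\<Sum>n. real n * c n * x ^ n)"
    using suminf_mult[OF termdiff_converges_all[OF assms, of x], of x] by (simp add: diffs_def mult_ac)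
qed

subsection \<open>The series with reciprocal Gamma coefficients\<close>

definition gcoeff :: "real \<Rightarrow> real \<Rightarrow> nat \<Rightarrow> real" where
  "gcoeff p q n = 1 / (Gamma (real n + p) * Gamma (real n + q))"

text \<open>For positive \<open>p\<close> and \<open>q\<close> this is the hypergeometric series
  \<open>1F2(1; p, q; t)\<close> divided by \<open>Gamma p * Gamma q\<close>.\<close>

definition gseries :: "real \<Rightarrow> real \<Rightarrow> real \<Rightarrow> real" where
  "gseries p q t = (\<Sum>n. gcoeff p q n * t ^ n)"

lemma Gamma_real_nonzero: "0 < x \<Longrightarrow> Gamma x \<noteq> 0" for x :: real
  using Gamma_real_pos[of x] by linarith

lemma gcoeff_pos: "0 < p \<Longrightarrow> 0 < q \<Longrightarrow> 0 < gcoeff p q n"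
  by (simp add: gcoeff_def)

lemma Gamma_real_Suc: "0 < p \<Longrightarrow> Gamma (real (Suc n) + p) = (real n + p) * Gamma (real n + p)"
  using Gamma_plus1[of "real n + p"] nonpos_Ints_nonpos[of "real n + p"]
  by (fastforce simp: add_ac)

lemma gcoeff_Suc:
  assumes "0 < p" "0 < q"
  shows "gcoeff p q n = (real n + p) * (real n + q) * gcoeff p q (Suc n)"
  using assms unfolding gcoeff_def Gamma_real_Suc[OF assms(1)] Gamma_real_Suc[OF assms(2)]
  by (simp add: add_nonneg_eq_0_iff)

lemma summable_gcoeff:
  assumes "0 < p" "0 < q"
  shows "summable (\<lambda>n. gcoeff p q n * t ^ n)"
proof -
  \<comment> \<open>From this \<open>N\<close> on, \<open>n * q\<close> exceeds
    \<open>2 * \<bar>t\<bar>\<close>, so each term is at most half of its predecessor in absolute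
    value.\<close>
  obtain N :: nat where N: "2 * \<bar>t\<bar> / q < real N"
    using reals_Archimedean2 by blast
  show ?thesis
  proof (rule summable_ratio_test[of "1/2" N])
    fix n assume "N \<le> n"
    then have "2 * \<bar>t\<bar> \<le> real n * q"
      using N assms by (smt (verit) of_nat_le_iff pos_divide_less_eq mult_right_mono)
    also have "\<dots> \<le> (real n + p) * (real n + q)"
      using assms by (intro mult_mono) auto
    finally have "2 * \<bar>t\<bar> * (gcoeff p q (Suc n) * \<bar>t\<bar> ^ n) \<le> (real n + p) * (real n + q) * (gcoeff p q (Suc n) * \<bar>t\<bar> ^ n)"
      using gcoeff_pos[OF assms, of "Suc n"] by (intro mult_right_mono) auto
    then show "norm (gcoeff p q (Suc n) * t ^ Suc n) \<le> 1/2 * norm (gcoeff p q n * t ^ n)"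
      using gcoeff_pos[OF assms, of "Suc n"] assms
      by (simp add: gcoeff_Suc[of p q n] abs_mult power_abs mult_ac)
  qed simp
qed

lemma gseries_pos:
  assumes "0 < p" "0 < q" "0 < t"
  shows "0 < gseries p q t"
  unfolding gseries_def
  using assms gcoeff_pos by (intro suminf_pos summable_gcoeff) auto

text \<open>By \<open>gcoeff_Suc\<close>, passing from \<open>n\<close> to \<open>n + 1\<close>
  multiplies the quotient by \<open>(n + p') * (n + q') / ((n + p) * (n + q))\<close>, which is at
  least 1.\<close>

lemma gcoeff_ratio_mono:
  assumes "0 < p" "0 < q" "0 < p'" "0 < q'"
    and "\<And>n. (real n + p) * (real n + q) \<le> (real n + p') * (real n + q')"
  shows "incseq (\<lambda>n. gcoeff p q n / gcoeff p' q' n)"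
proof (rule powser_ratio_step)
  fix n
  have "gcoeff p q (Suc n) * gcoeff p' q' (Suc n) * ((real n + p) * (real n + q))
      \<le> gcoeff p q (Suc n) * gcoeff p' q' (Suc n) * ((real n + p') * (real n + q'))"
    using assms gcoeff_pos[of p q "Suc n"] gcoeff_pos[of p' q' "Suc n"] by (intro mult_left_mono) auto
  then show "gcoeff p q n * gcoeff p' q' (Suc n) \<le> gcoeff p q (Suc n) * gcoeff p' q' n"
    using assms by (simp add: gcoeff_Suc[of p q n] gcoeff_Suc[of p' q' n] mult_ac)
qed (use assms gcoeff_pos in auto)

text \<open>Reduces the monotonicity in (a)-(d) to comparing two quadratics in
  \<open>n\<close>.\<close>

lemma gseries_ratio_mono:
  assumes "0 < p" "0 < q" "0 < p'" "0 < q'"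
    and "\<And>n. (real n + p) * (real n + q) \<le> (real n + p') * (real n + q')"
    and "0 < s" "s \<le> t"
  shows "gseries p q s / gseries p' q' s \<le> gseries p q t / gseries p' q' t"
proof -
  have "gseries p q s * gseries p' q' t \<le> gseries p q t * gseries p' q' s"
    unfolding gseries_def
    using assms gcoeff_pos by (intro powser_ratio_mono gcoeff_ratio_mono summable_gcoeff) auto
  then show ?thesis
    using gseries_pos[of p' q' s] gseries_pos[of p' q' t] assms by (simp add: field_simps)
qed

text \<open>The Gamma factors normalize both constant terms to 1. Since the coefficient quotient
  increases with \<open>n\<close>, the terms compare one by one; the condition on
  \<open>p * q\<close> makes the comparison strict at \<open>n = 1\<close>.\<close>

lemma gseries_normalized_less:
  assumes "0 < p" "0 < q" "0 < p'" "0 < q'"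
    and "\<And>n. (real n + p) * (real n + q) \<le> (real n + p') * (real n + q')" and "p * q < p' * q'"
    and t: "0 < t"
  shows "Gamma p' * Gamma q' * gseries p' q' t < Gamma p * Gamma q * gseries p q t"
proof -
  define d where "d n = (Gamma p * Gamma q * gcoeff p q n - Gamma p' * Gamma q' * gcoeff p' q' n) * t ^ n" for n
  have 0: "Gamma p * Gamma q * gcoeff p q 0 = 1" "Gamma p' * Gamma q' * gcoeff p' q' 0 = 1"
    using assms(1-4) by (auto simp: gcoeff_def Gamma_real_nonzero)
  have "0 \<le> d n" for n
  proof -
    have "gcoeff p q 0 / gcoeff p' q' 0 \<le> gcoeff p q n / gcoeff p' q' n"
      using gcoeff_ratio_mono[of p q p' q'] assms by (auto simp: incseq_def)
    then show ?thesis
      using gcoeff_pos[of p' q' n] assms(1-4) t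
      by (simp add: d_def gcoeff_def field_simps)
  qed
  moreover have "0 < d 1"
  proof -
    have e: "Gamma p * Gamma q * gcoeff p q 1 = 1 / (p * q)" "Gamma p' * Gamma q' * gcoeff p' q' 1 = 1 / (p' * q')"
      using 0 gcoeff_Suc[of p q 0] gcoeff_Suc[of p' q' 0] assms by (simp_all add: field_simps)
    show ?thesis
      unfolding d_def e using assms by (simp add: frac_less2)
  qed
  moreover have s: "d sums (Gamma p * Gamma q * gseries p q t - Gamma p' * Gamma q' * gseries p' q' t)"
    unfolding d_def gseries_def left_diff_distrib mult.assoc[of _ _ "_ ^ _"]
    using assms by (intro sums_diff sums_mult summable_sums summable_gcoeff) auto
  ultimately have "0 < suminf d"
    by (intro suminf_pos2[of _ 1]) (auto simp: sums_iff)
  then show ?thesis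
    using s by (simp add: sums_iff)
qed

text \<open>Splitting off the term at 0 and shifting the index raises both parameters by one. This
  links the series of order \<open>\<nu> + 1\<close> to one that shares its second parameter with
  order \<open>\<nu>\<close>.\<close>

lemma gseries_eq_mult:
  assumes "0 < p" "0 < q"
  shows "gseries p q t = gcoeff p q 0 + t * gseries (p + 1) (q + 1) t"
  using suminf_split_head[OF summable_gcoeff[OF assms, of t]]
    suminf_mult[OF summable_gcoeff[of "p+1" "q+1" t], of t] assms
  by (simp add: gseries_def gcoeff_def add_ac)

text \<open>Lowering the first parameter from \<open>p + 1\<close> to \<open>p\<close> multiplies
  the \<open>n\<close>-th coefficient by \<open>n + p\<close>. Hence, for positive \<open>t\<close>,
  \<open>gseries p q t / gseries (p + 1) q t\<close> is \<open>p\<close> plus a weighted mean of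
  \<open>n\<close>.\<close>

lemma gseries_shift:
  assumes "0 < p" "0 < q"
  shows "gseries p q t = (\<Sum>n. real n * gcoeff (p + 1) q n * t ^ n) + p * gseries (p + 1) q t"
proof -
  have c: "gcoeff p q n = (real n + p) * gcoeff (p + 1) q n" for n
    using Gamma_real_Suc[OF assms(1), of n] assms by (simp add: gcoeff_def add_ac)
  have "(\<lambda>n. real n * gcoeff (p + 1) q n * t ^ n + p * (gcoeff (p + 1) q n * t ^ n)) sums
     ((\<Sum>n. real n * gcoeff (p + 1) q n * t ^ n) + p * gseries (p + 1) q t)"
    unfolding gseries_def using assms
    by (intro sums_add sums_mult summable_sums summable_gcoeff summable_of_nat_mult) auto
  then show ?thesis
    by (simp add: gseries_def sums_iff c algebra_simps)
qed

text \<open>Both sides are \<open>p\<close> plus the mean of \<open>n\<close>, under the weights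
  \<open>?c n * t ^ n\<close> and \<open>?b n * t ^ n\<close>. The quotient
  \<open>?c n / ?b n\<close> decreases in \<open>n\<close>, so passing to the larger
  \<open>q'\<close> favours small \<open>n\<close> and lowers the mean.\<close>

lemma gseries_shift_ratio_mono:
  assumes "0 < p" "0 < q" "q \<le> q'" "0 < t"
  shows "gseries p q' t / gseries (p + 1) q' t \<le> gseries p q t / gseries (p + 1) q t"
proof -
  let ?b = "gcoeff (p + 1) q" and ?c = "gcoeff (p + 1) q'"
  have q': "0 < q'"
    using assms by simp
  have pos: "0 < ?b n" "0 < ?c n" for n
    using assms by (auto intro!: gcoeff_pos)
  have s: "summable (\<lambda>n. ?b n * x ^ n)" "summable (\<lambda>n. ?c n * x ^ n)" for x
    using assms by (auto intro!: summable_gcoeff)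
  note s1 = summable_of_nat_mult[OF s(1)] summable_of_nat_mult[OF s(2)]
  have eq: "?b n * t ^ n * real n = real n * ?b n * t ^ n"
    "?b n * t ^ n * - (?c n / ?b n) = - (?c n * t ^ n)"
    "real n * ?b n * t ^ n * - (?c n / ?b n) = - (real n * ?c n * t ^ n)" for n
    using pos[of n] by auto
  \<comment> \<open>The sign turns the decreasing quotient into an increasing one, as Chebyshev's
    inequality requires.\<close>
  have "incseq (\<lambda>n. - (?c n / ?b n))"
  proof -
    have "incseq (\<lambda>n. ?b n / ?c n)"
      using assms by (intro gcoeff_ratio_mono) (auto intro!: mult_left_mono)
    then show ?thesis
      using pos by (simp add: incseq_def field_simps)
  qed
  from Chebyshev_suminf[of "\<lambda>n. ?b n * t ^ n" real, OF _ _ this]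
  have "(\<Sum>n. real n * ?b n * t ^ n) * (\<Sum>n. - (?c n * t ^ n))
      \<le> gseries (p + 1) q t * (\<Sum>n. - (real n * ?c n * t ^ n))"
    using pos assms s s1 by (simp only: eq gseries_def) (simp add: incseq_def summable_minus)
  then have "(\<Sum>n. real n * ?c n * t ^ n) * gseries (p + 1) q t \<le> (\<Sum>n. real n * ?b n * t ^ n) * gseries (p + 1) q' t"
    using s s1 by (simp add: suminf_minus gseries_def algebra_simps)
  then show ?thesis
    using gseries_pos[of "p + 1" q t] gseries_pos[of "p + 1" q' t] assms
      gseries_shift[of p q t] gseries_shift[of p q' t]
    by (simp add: divide_simps) (simp add: algebra_simps)
qed

subsection \<open>Log-convexity\<close>

lemma convex_comb_mem:
  fixes S :: "real set"
  assumes "convex S" "x \<in> S" "y \<in> S" "0 < t" "t < 1"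
  shows "(1 - t) * x + t * y \<in> S"
  using assms convexD[of S x y "1 - t" t] by simp

text \<open>The AM-GM form of log-convexity is linear in \<open>f\<close>, hence passes to sums and integrals.\<close>

lemma log_convex_onD_AMGM:
  assumes lc: "log_convex_on S f" and "convex S" and x: "x \<in> S" and y: "y \<in> S" and t: "0 < t" "t < 1"
    and A: "0 < A" and B: "0 < B"
  shows "f ((1 - t) * x + t * y) \<le> A powr (1 - t) * B powr t * ((1 - t) * (f x / A) + t * (f y / B))"
proof -
  let ?z = "(1 - t) * x + t * y"
  have pos: "0 < f x" "0 < f y" "0 < f ?z"
    using lc x y t convex_comb_mem[OF assms(2-6)] by (auto simp: log_convex_on_def)
  have "ln (f ?z) \<le> (1 - t) * ln (f x) + t * ln (f y)"
    using lc x y t convex_onD[of S "\<lambda>x. ln (f x)" t x y] by (auto simp: log_convex_on_def)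
  then have "exp (ln (f ?z)) \<le> exp ((1 - t) * ln (f x) + t * ln (f y))"
    by (simp only: exp_le_cancel_iff)
  then have "f ?z \<le> f x powr (1 - t) * f y powr t"
    using pos by (simp add: powr_def exp_add)
  also have "\<dots> = A powr (1 - t) * B powr t * ((f x / A) powr (1 - t) * (f y / B) powr t)"
    using pos A B by (simp add: powr_divide)
  also have "\<dots> \<le> A powr (1 - t) * B powr t * ((1 - t) * (f x / A) + t * (f y / B))"
    using pos A B t by (intro mult_left_mono Youngs_inequality_0) auto
  finally show ?thesis .
qed

text \<open>Nothing is lost by the AM-GM bound because the scales are free: at
  \<open>A = f x\<close> and \<open>B = f y\<close> its last factor is 1 and the geometric bound
  remains.\<close>

lemma log_convex_onI_AMGM:
  assumes "convex S" and pos: "\<And>x. x \<in> S \<Longrightarrow> 0 < f x"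
    and AMGM: "\<And>x y t A B. \<lbrakk>x \<in> S; y \<in> S; 0 < t; t < 1; 0 < A; 0 < B\<rbrakk> \<Longrightarrow>
      f ((1 - t) * x + t * y) \<le> A powr (1 - t) * B powr t * ((1 - t) * (f x / A) + t * (f y / B))"
  shows "log_convex_on S f"
  unfolding log_convex_on_def
proof (intro conjI ballI convex_onI)
  fix t x y :: real
  assume t: "0 < t" "t < 1" and x: "x \<in> S" and y: "y \<in> S"
  have p: "0 < f x" "0 < f y" "0 < f ((1 - t) * x + t * y)"
    using convex_comb_mem[OF assms(1) x y t] x y by (auto intro: pos)
  have "f ((1 - t) * x + t * y) \<le> f x powr (1 - t) * f y powr t"
    using AMGM[OF x y t p(1) p(2)] p by simp
  then have "ln (f ((1 - t) * x + t * y)) \<le> ln (f x powr (1 - t) * f y powr t)"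
    using p by simp
  then show "ln (f ((1 - t) *\<^sub>R x + t *\<^sub>R y)) \<le> (1 - t) * ln (f x) + t * ln (f y)"
    using p by (simp add: ln_mult ln_powr)
qed (use assms in auto)

lemma log_convex_on_cong:
  assumes "\<And>x. x \<in> S \<Longrightarrow> f x = g x"
  shows "log_convex_on S f \<longleftrightarrow> log_convex_on S g"
proof -
  have "log_convex_on S f'" if "log_convex_on S f" "\<And>x. x \<in> S \<Longrightarrow> f x = f' x" for f f'
    using that convex_comb_mem[of S]
    by (auto simp: log_convex_on_def convex_on_imp_convex intro!: convex_onI dest: convex_onD)
       (smt (verit) convex_onD convex_on_imp_convex real_scaleR_def)
  then show ?thesis
    using assms by metis
qed

lemma log_convex_on_mult:
  assumes "log_convex_on S f" "log_convex_on S g"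
  shows "log_convex_on S (\<lambda>x. f x * g x)"
proof -
  have "convex_on S (\<lambda>x. ln (f x) + ln (g x))"
    using assms by (intro convex_on_add) (auto simp: log_convex_on_def)
  then have "log_convex_on S (\<lambda>x. exp (ln (f x) + ln (g x)))"
    by (simp add: log_convex_on_def)
  then show ?thesis
    by (rule log_convex_on_cong[THEN iffD1, rotated])
      (use assms in \<open>auto simp: log_convex_on_def exp_add\<close>)
qed

lemma log_convex_on_const: "convex S \<Longrightarrow> 0 < c \<Longrightarrow> log_convex_on S (\<lambda>_. c)"
  by (auto simp: log_convex_on_def convex_on_const)

lemma log_convex_on_suminf:
  assumes "convex S" and lc: "\<And>n. log_convex_on S (f n)"
    and summable: "\<And>x. x \<in> S \<Longrightarrow> summable (\<lambda>n. f n x)"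
  shows "log_convex_on S (\<lambda>x. \<Sum>n. f n x)"
proof (rule log_convex_onI_AMGM)
  show "0 < (\<Sum>n. f n x)" if "x \<in> S" for x
    using that lc summable by (intro suminf_pos) (auto simp: log_convex_on_def)
  fix x y t A B :: real
  assume *: "x \<in> S" "y \<in> S" "0 < t" "t < 1" "0 < A" "0 < B"
  let ?C = "A powr (1 - t) * B powr t"
  have sums: "(\<lambda>n. ?C * ((1 - t) * (f n x / A) + t * (f n y / B))) sums
      (?C * ((1 - t) * ((\<Sum>n. f n x) / A) + t * ((\<Sum>n. f n y) / B)))"
    using * by (intro sums_mult sums_add sums_divide summable_sums summable)
  have "(\<Sum>n. f n ((1 - t) * x + t * y)) \<le> (\<Sum>n. ?C * ((1 - t) * (f n x / A) + t * (f n y / B)))"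
    using * sums assms
    by (intro suminf_le summable convex_comb_mem log_convex_onD_AMGM[where S = S]) (auto simp: sums_iff)
  with sums show "(\<Sum>n. f n ((1 - t) * x + t * y)) \<le> ?C * ((1 - t) * ((\<Sum>n. f n x) / A) + t * ((\<Sum>n. f n y) / B))"
    by (simp add: sums_iff)
qed fact

text \<open>The weight \<open>w\<close> may vanish, so positivity of \<open>F\<close> is assumed
  separately.\<close>

lemma log_convex_on_integral:
  fixes w :: "'a::euclidean_space \<Rightarrow> real"
  assumes "convex S" and lc: "\<And>u. u \<in> I \<Longrightarrow> log_convex_on S (f u)"
    and w: "\<And>u. u \<in> I \<Longrightarrow> 0 \<le> w u"
    and int: "\<And>x. x \<in> S \<Longrightarrow> ((\<lambda>u. w u * f u x) has_integral F x) I"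
    and pos: "\<And>x. x \<in> S \<Longrightarrow> 0 < F x"
  shows "log_convex_on S F"
proof (rule log_convex_onI_AMGM)
  fix x y t A B :: real
  assume *: "x \<in> S" "y \<in> S" "0 < t" "t < 1" "0 < A" "0 < B"
  let ?C = "A powr (1 - t) * B powr t"
  have le: "w u * f u ((1 - t) * x + t * y) \<le> ?C * ((1 - t) * (w u * f u x / A) + t * (w u * f u y / B))"
    if "u \<in> I" for u
    using mult_left_mono[OF log_convex_onD_AMGM[OF lc[OF that] assms(1) *] w[OF that]]
    by (simp add: algebra_simps)
  have int2: "((\<lambda>u. ?C * ((1 - t) * (w u * f u x / A) + t * (w u * f u y / B))) has_integral
      ?C * ((1 - t) * (F x / A) + t * (F y / B))) I"
    using * by (intro has_integral_mult_right has_integral_add has_integral_divide int)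
  show "F ((1 - t) * x + t * y) \<le> ?C * ((1 - t) * (F x / A) + t * (F y / B))"
    using * assms(1) by (intro has_integral_le[OF int int2 le] convex_comb_mem) auto
qed fact+

lemma log_convex_on_add:
  assumes "convex S" and f: "log_convex_on S f" and g: "log_convex_on S g"
  shows "log_convex_on S (\<lambda>x. f x + g x)"
proof (rule log_convex_onI_AMGM)
  fix x y t A B :: real
  assume *: "x \<in> S" "y \<in> S" "0 < t" "t < 1" "0 < A" "0 < B"
  show "f ((1 - t) * x + t * y) + g ((1 - t) * x + t * y)
      \<le> A powr (1 - t) * B powr t * ((1 - t) * ((f x + g x) / A) + t * ((f y + g y) / B))"
    using add_mono[OF log_convex_onD_AMGM[OF f assms(1) *] log_convex_onD_AMGM[OF g assms(1) *]]
    by (simp add: distrib_left add_divide_distrib add_ac)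
qed (use assms in \<open>auto simp: log_convex_on_def add_pos_pos\<close>)

text \<open>Half the sum of two exponentials whose logarithms are linear.\<close>

lemma log_convex_on_cosh: "log_convex_on {0<..} (\<lambda>x. cosh (c * x))"
proof -
  have exp: "log_convex_on {0<..} (\<lambda>x. exp (d * x))" for d :: real
    by (auto simp: log_convex_on_def intro!: convex_onI simp: algebra_simps)
  have "log_convex_on {0<..} (\<lambda>x. 1/2 * (exp (c * x) + exp (- c * x)))"
    by (intro log_convex_on_mult log_convex_on_add log_convex_on_const exp) auto
  then show ?thesis
    by (simp add: cosh_def)
qed

lemma log_convex_on_inverse_shift: "a \<le> b \<Longrightarrow> log_convex_on {- a<..} (\<lambda>x. 1 / (x + b))"
proof -
  assume ab: "a \<le> b"
  have ln: "convex_on {0<..} (\<lambda>x::real. - ln x)"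
    using minus_log_convex[of "exp 1"] by (simp add: log_def)
  have "convex_on {- a<..} (\<lambda>x. - ln (x + b))"
  proof (intro convex_onI)
    fix t x y :: real
    assume t: "0 < t" "t < 1" and "x \<in> {- a<..}" "y \<in> {- a<..}"
    then show "- ln ((1 - t) *\<^sub>R x + t *\<^sub>R y + b) \<le> (1 - t) * - ln (x + b) + t * - ln (y + b)"
      using convex_onD[OF ln, of t "x + b" "y + b"] ab by (auto simp: algebra_simps)
  qed auto
  then have "log_convex_on {- a<..} (\<lambda>x. exp (- ln (x + b)))"
    by (simp add: log_convex_on_def)
  then show ?thesis
    by (rule log_convex_on_cong[THEN iffD1, rotated]) (use ab in \<open>simp add: exp_minus inverse_eq_divide\<close>)
qed

text \<open>The quotient is the product of \<open>1 / (\<nu> + a + k)\<close> over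
  \<open>k < n\<close>, and each factor is log-convex.\<close>

lemma log_convex_on_Gamma_quotient:
  "log_convex_on {- a<..} (\<lambda>\<nu>. Gamma (\<nu> + a) / Gamma (real n + (\<nu> + a)))"
proof (induction n)
  case 0
  have "log_convex_on {- a<..} (\<lambda>\<nu>. 1)"
    by (intro log_convex_on_const) auto
  then show ?case
    by (rule log_convex_on_cong[THEN iffD1, rotated])
      (simp add: Gamma_real_nonzero)
next
  case (Suc n)
  have "log_convex_on {- a<..} (\<lambda>\<nu>. 1 / (\<nu> + (real n + a)))"
    by (intro log_convex_on_inverse_shift) auto
  from log_convex_on_mult[OF Suc this] show ?case
    by (rule log_convex_on_cong[THEN iffD1, rotated])
      (use Gamma_real_Suc[of "_ + a" n] in \<open>auto simp: add_ac\<close>)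
qed

subsection \<open>Elementary special cases and an integral representation\<close>

text \<open>An instance of the duplication formula. It turns the coefficients for
  \<open>(p, q) = (1/2, 1)\<close> into those of \<open>cosh\<close>, the power of 4 being absorbed
  by \<open>(x / 2)^2\<close>.\<close>

lemma Gamma_half_fact: "Gamma (real n + 1/2) * fact n * 4 ^ n = sqrt pi * fact (2 * n)"
proof (induction n)
  case 0
  show ?case
    by (simp add: Gamma_one_half_real)
next
  case (Suc n)
  have "Gamma (real (Suc n) + 1/2) * fact (Suc n) * 4 ^ Suc n
      = (Gamma (real n + 1/2) * fact n * 4 ^ n) * ((real n + 1/2) * (real n + 1) * 4)"
    by (subst Gamma_real_Suc) (auto simp: algebra_simps)
  also have "\<dots> = sqrt pi * fact (2 * Suc n)"
    unfolding Suc.IH by (simp add: algebra_simps)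
  finally show ?case .
qed

lemma Gamma_nat_plus_one: "Gamma (real n + 1) = fact n"
  using Gamma_fact[of n, where 'a = real] by (simp add: add_ac)

lemma gseries_half_1: "gseries (1/2) 1 ((x/2)\<^sup>2) = cosh x / sqrt pi"
proof -
  have "(\<lambda>n. if even n then x ^ n /\<^sub>R fact n else 0) sums cosh x"
    by (rule cosh_converges)
  \<comment> \<open>The odd-indexed terms of the series are zero, so reindexing along
    \<open>2 * n\<close> keeps the sum.\<close>
  then have "(\<lambda>n. x ^ (2 * n) /\<^sub>R fact (2 * n)) sums cosh x"
    by (subst (asm) sums_mono_reindex[of "\<lambda>n. 2 * n", symmetric])
      (auto simp: strict_mono_def elim!: evenE)
  then have "(\<lambda>n. x ^ (2 * n) /\<^sub>R fact (2 * n) / sqrt pi) sums (cosh x / sqrt pi)"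
    by (rule sums_divide)
  also have "(\<lambda>n. x ^ (2 * n) /\<^sub>R fact (2 * n) / sqrt pi) = (\<lambda>n. gcoeff (1/2) 1 n * ((x/2)\<^sup>2) ^ n)"
  proof
    fix n
    have pos: "Gamma (real n + 1/2) \<noteq> 0"
      by (rule Gamma_real_nonzero) simp
    have p: "((x/2)\<^sup>2) ^ n = x ^ (2 * n) / 4 ^ n"
      by (simp add: power_divide power_mult)
    have "gcoeff (1/2) 1 n * ((x/2)\<^sup>2) ^ n * (sqrt pi * fact (2 * n)) = x ^ (2 * n)"
      unfolding p gcoeff_def Gamma_nat_plus_one Gamma_half_fact[symmetric] using pos
      by simp
    then show "x ^ (2 * n) /\<^sub>R fact (2 * n) / sqrt pi = gcoeff (1/2) 1 n * ((x/2)\<^sup>2) ^ n"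
      by (simp add: field_simps)
  qed
  finally show ?thesis
    by (simp add: gseries_def sums_iff)
qed

lemma gseries_three_halves_1: "x / 2 * gseries (3/2) 1 ((x/2)\<^sup>2) = sinh x / sqrt pi"
proof -
  have "(\<lambda>n. if even n then 0 else x ^ n /\<^sub>R fact n) sums sinh x"
    by (rule sinh_converges)
  then have "(\<lambda>n. x ^ (2 * n + 1) /\<^sub>R fact (2 * n + 1)) sums sinh x"
    by (subst (asm) sums_mono_reindex[of "\<lambda>n. 2 * n + 1", symmetric])
      (auto simp: strict_mono_def elim!: oddE)
  then have "(\<lambda>n. x ^ (2 * n + 1) /\<^sub>R fact (2 * n + 1) / sqrt pi) sums (sinh x / sqrt pi)"
    by (rule sums_divide)
  also have "(\<lambda>n. x ^ (2 * n + 1) /\<^sub>R fact (2 * n + 1) / sqrt pi) = (\<lambda>n. x / 2 * (gcoeff (3/2) 1 n * ((x/2)\<^sup>2) ^ n))"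
  proof
    fix n
    have pos: "Gamma (real n + 1/2) \<noteq> 0"
      by (rule Gamma_real_nonzero) simp
    have G: "Gamma (real n + 3/2) = (real n + 1/2) * Gamma (real n + 1/2)"
      using Gamma_real_Suc[of "1/2" n] by (simp add: add_ac)
    have p: "((x/2)\<^sup>2) ^ n = x ^ (2 * n) / 4 ^ n"
      by (simp add: power_divide power_mult)
    have "gcoeff (3/2) 1 n * ((x/2)\<^sup>2) ^ n * (sqrt pi * fact (2 * n) * (real n + 1/2)) = x ^ (2 * n)"
      unfolding p G gcoeff_def Gamma_nat_plus_one Gamma_half_fact[symmetric] using pos
      by (simp add: add_nonneg_eq_0_iff)
    then have "gcoeff (3/2) 1 n * ((x/2)\<^sup>2) ^ n = x ^ (2 * n) / (sqrt pi * fact (2 * n) * (real n + 1/2))"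
      by (simp add: eq_divide_eq add_nonneg_eq_0_iff)
    then show "x ^ (2 * n + 1) /\<^sub>R fact (2 * n + 1) / sqrt pi = x / 2 * (gcoeff (3/2) 1 n * ((x/2)\<^sup>2) ^ n)"
      by (simp add: divide_simps) (simp add: algebra_simps)
  qed
  finally have "sinh x / sqrt pi = (\<Sum>n. x / 2 * (gcoeff (3/2) 1 n * ((x/2)\<^sup>2) ^ n))"
    by (simp add: sums_iff)
  then show ?thesis
    using suminf_mult[OF summable_gcoeff[of "3/2" 1 "(x/2)\<^sup>2"], of "x/2"] by (simp add: gseries_def)
qed

text \<open>An index shift in the \<open>cosh\<close> series; the constant term split off produces
  the \<open>- 1\<close>.\<close>

lemma gseries_three_halves_2: "(x/2)\<^sup>2 * gseries (3/2) 2 ((x/2)\<^sup>2) = (cosh x - 1) / sqrt pi"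
  using gseries_eq_mult[of "1/2" 1 "(x/2)\<^sup>2"]
  by (simp add: gseries_half_1 gcoeff_def Gamma_one_half_real diff_divide_distrib)

text \<open>Term by term, \<open>Beta (n + 1) (a - 1)\<close> replaces \<open>Gamma (n + 1)\<close>
  in the denominator by \<open>Gamma (n + a)\<close>, up to the factor
  \<open>Gamma (a - 1)\<close>.\<close>

lemma has_integral_gseries:
  assumes p: "0 < p" and a: "1 < a" and t: "0 \<le> t"
  shows "((\<lambda>u. (1 - u) powr (a - 2) * gseries p 1 (t * u)) has_integral Gamma (a - 1) * gseries p a t) {0<..<1}"
proof -
  define f where "f k u = (\<Sum>n<k. gcoeff p 1 n * t ^ n * (u powr real n * (1 - u) powr (a - 2)))" for k u
  have beta: "((\<lambda>u. u powr real n * (1 - u) powr (a - 2)) has_integral Beta (real n + 1) (a - 1)) {0<..<1}" for n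
    using has_integral_Beta_real[of "real n + 1" "a - 1"] a
    by (simp add: has_integral_Icc_iff_Ioo algebra_simps)
  have coeff: "gcoeff p 1 n * t ^ n * Beta (real n + 1) (a - 1) = Gamma (a - 1) * (gcoeff p a n * t ^ n)" for n
    using Gamma_real_nonzero[of "real n + 1"] by (simp add: gcoeff_def Beta_def add_ac)
  have f: "(f k has_integral Gamma (a - 1) * (\<Sum>n<k. gcoeff p a n * t ^ n)) {0<..<1}" for k
    unfolding f_def sum_distrib_left coeff[symmetric]
    by (intro has_integral_sum has_integral_mult_right beta) auto
  have lim: "(\<lambda>k. Gamma (a - 1) * (\<Sum>n<k. gcoeff p a n * t ^ n)) \<longlonglongrightarrow> Gamma (a - 1) * gseries p a t"
    unfolding gseries_def using p a by (intro tendsto_mult tendsto_const summable_LIMSEQ summable_gcoeff) auto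
  \<comment> \<open>Since \<open>t\<close> is nonnegative, the partial sums increase, and monotone
    convergence allows the exchange of sum and integral.\<close>
  have "(\<lambda>u. (1 - u) powr (a - 2) * gseries p 1 (t * u)) integrable_on {0<..<1} \<and>
    (\<lambda>k. integral {0<..<1} (f k)) \<longlonglongrightarrow> integral {0<..<1} (\<lambda>u. (1 - u) powr (a - 2) * gseries p 1 (t * u))"
  proof (rule monotone_convergence_increasing)
    show "f k integrable_on {0<..<1}" for k
      using f by blast
    show "f k u \<le> f (Suc k) u" for k u
      using gcoeff_pos[of p 1 k] p t by (simp add: f_def)
    show "bounded (range (\<lambda>k. integral {0<..<1} (f k)))"
      using convergent_imp_bounded[OF lim] by (simp add: integral_unique[OF f])
    fix u :: real assume u: "u \<in> {0<..<1}"
    have "f k u = (1 - u) powr (a - 2) * (\<Sum>n<k. gcoeff p 1 n * (t * u) ^ n)" for k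
      using u by (simp add: f_def sum_distrib_left powr_realpow power_mult_distrib mult_ac)
    then show "(\<lambda>k. f k u) \<longlonglongrightarrow> (1 - u) powr (a - 2) * gseries p 1 (t * u)"
      unfolding gseries_def using p by (auto intro!: tendsto_mult summable_LIMSEQ summable_gcoeff)
  qed
  moreover have "(\<lambda>k. integral {0<..<1} (f k)) \<longlonglongrightarrow> Gamma (a - 1) * gseries p a t"
    using lim by (simp add: integral_unique[OF f])
  ultimately show ?thesis
    using LIMSEQ_unique has_integral_integral by metis
qed

text \<open>For \<open>a > 1\<close> the function is an average of \<open>cosh (sqrt u * x)\<close>
  over \<open>u\<close> with a nonnegative Beta weight. The weight degenerates at
  \<open>a = 1\<close>, where the function is itself a multiple of \<open>cosh\<close>.\<close>

lemma log_convex_on_gseries_half: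
  assumes "1 \<le> a"
  shows "log_convex_on {0<..} (\<lambda>x. gseries (1/2) a ((x/2)\<^sup>2))"
proof (cases "a = 1")
  case True
  have "log_convex_on {0<..} (\<lambda>x. 1 / sqrt pi * cosh (1 * x))"
    by (intro log_convex_on_mult log_convex_on_const log_convex_on_cosh) auto
  then show ?thesis
    by (simp add: True gseries_half_1)
next
  case False
  with assms have a: "1 < a"
    by simp
  have "((\<lambda>u. ((1 - u) powr (a - 2) / (sqrt pi * Gamma (a - 1))) * cosh (sqrt u * x)) has_integral gseries (1/2) a ((x/2)\<^sup>2)) {0<..<1}" for x
  proof -
    have "((\<lambda>u. 1 / Gamma (a - 1) * ((1 - u) powr (a - 2) * gseries (1/2) 1 ((x/2)\<^sup>2 * u))) has_integral
        1 / Gamma (a - 1) * (Gamma (a - 1) * gseries (1/2) a ((x/2)\<^sup>2))) {0<..<1}"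
      by (intro has_integral_mult_right has_integral_gseries) (use a in auto)
    also have "1 / Gamma (a - 1) * (Gamma (a - 1) * gseries (1/2) a ((x/2)\<^sup>2)) = gseries (1/2) a ((x/2)\<^sup>2)"
      using Gamma_real_nonzero[of "a - 1"] a by simp
    finally show ?thesis
    proof (rule has_integral_eq[rotated])
      fix u :: real assume "u \<in> {0<..<1}"
      then have "(x/2)\<^sup>2 * u = ((sqrt u * x) / 2)\<^sup>2"
        by (simp add: power_divide power_mult_distrib)
      then show "1 / Gamma (a - 1) * ((1 - u) powr (a - 2) * gseries (1/2) 1 ((x/2)\<^sup>2 * u))
          = ((1 - u) powr (a - 2) / (sqrt pi * Gamma (a - 1))) * cosh (sqrt u * x)"
        by (simp only: gseries_half_1) simp
    qed
  qed
  then show ?thesis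
    using a by (intro log_convex_on_integral[where f = "\<lambda>u x. cosh (sqrt u * x)" and I = "{0<..<1}"
        and w = "\<lambda>u. (1 - u) powr (a - 2) / (sqrt pi * Gamma (a - 1))", OF _ log_convex_on_cosh])
      (auto intro!: gseries_pos divide_nonneg_nonneg mult_nonneg_nonneg)
qed

section \<open>Variance, differential equation and Turan inequality for the series\<close>

lemma powser_moment_strict:
  fixes c :: "nat \<Rightarrow> real"
  assumes c: "\<And>n. 0 < c n" and s: "\<And>x. summable (\<lambda>n. c n * x ^ n)" and t: "0 < t"
  shows "(\<Sum>n. real n * c n * t ^ n)\<^sup>2 < (\<Sum>n. c n * t ^ n) * (\<Sum>n. real n * (real n * c n) * t ^ n)"
proof -
  define S0 where "S0 = (\<Sum>n. c n * t ^ n)"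
  define S1 where "S1 = (\<Sum>n. real n * c n * t ^ n)"
  define S2 where "S2 = (\<Sum>n. real n * (real n * c n) * t ^ n)"
  \<comment> \<open>The mean of \<open>n\<close>. With this \<open>m\<close> the quantity
    \<open>S2 - 2 * m * S1 + m^2 * S0\<close> is \<open>S0\<close> times the variance of
    \<open>n\<close>.\<close>
  define m where "m = S1 / S0"
  note s1 = summable_of_nat_mult[OF s] and s2 = summable_of_nat_mult[OF summable_of_nat_mult[OF s]]
  have S0: "0 < S0"
    unfolding S0_def using c t s by (intro suminf_pos) auto
  have "(\<lambda>n. real n * (real n * c n) * t ^ n - 2 * m * (real n * c n * t ^ n) + m\<^sup>2 * (c n * t ^ n)) sums
      (S2 - 2 * m * S1 + m\<^sup>2 * S0)"
    unfolding S0_def S1_def S2_def by (intro sums_add sums_diff sums_mult summable_sums s s1 s2)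
  then have sums: "(\<lambda>n. (real n - m)\<^sup>2 * (c n * t ^ n)) sums (S2 - 2 * m * S1 + m\<^sup>2 * S0)"
    by (simp add: power2_eq_square algebra_simps)
  \<comment> \<open>Strictness: \<open>m\<close> cannot equal both 0 and 1, so some square is
    positive.\<close>
  obtain i :: nat where "real i \<noteq> m"
    by (metis of_nat_0 of_nat_1 zero_neq_one)
  then have "0 < (\<Sum>n. (real n - m)\<^sup>2 * (c n * t ^ n))"
    using sums c t by (intro suminf_pos2[of _ i]) (auto simp: sums_iff less_imp_le)
  then have "0 < S2 - 2 * m * S1 + m\<^sup>2 * S0"
    using sums by (simp add: sums_iff)
  then have "0 < (S2 - 2 * m * S1 + m\<^sup>2 * S0) * S0"
    using S0 by simp
  also have "\<dots> = S0 * S2 - S1\<^sup>2"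
    using S0 by (simp add: m_def power2_eq_square field_simps)
  finally show ?thesis
    by (simp add: S0_def S1_def S2_def)
qed

text \<open>With \<theta> the Euler operator in \<open>t\<close>, this is the equation
  \<open>(\<theta> + p - 1) (\<theta> + q - 1) G = t G + const\<close>. The left factors cancel
  against \<open>gcoeff_Suc\<close> for positive index, and the term at 0 gives the
  constant.\<close>

lemma gseries_ODE:
  assumes "0 < p" "0 < q"
  shows "(\<Sum>n. real n * (real n * gcoeff p q n) * t ^ n) + (p + q - 2) * (\<Sum>n. real n * gcoeff p q n * t ^ n)
      + (p - 1) * (q - 1) * gseries p q t = t * gseries p q t + (p - 1) * (q - 1) * gcoeff p q 0"
    (is "?S = _")
proof -
  note s = summable_gcoeff[OF assms]
  let ?f = "\<lambda>n. (real n + p - 1) * (real n + q - 1) * (gcoeff p q n * t ^ n)"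
  have step: "?f (Suc n) = t * (gcoeff p q n * t ^ n)" for n
    by (simp add: gcoeff_Suc[OF assms, of n] add_ac mult_ac)
  have "(\<lambda>n. real n * (real n * gcoeff p q n) * t ^ n + (p + q - 2) * (real n * gcoeff p q n * t ^ n)
      + (p - 1) * (q - 1) * (gcoeff p q n * t ^ n)) sums ?S"
    unfolding gseries_def by (intro sums_add sums_mult summable_sums s summable_of_nat_mult)
  then have "?f sums ?S"
    by (simp add: algebra_simps)
  then have "?S = (\<Sum>n. ?f (Suc n)) + ?f 0"
    using suminf_split_head[of ?f] by (simp add: sums_iff)
  also have "(\<lambda>n. ?f (Suc n)) = (\<lambda>n. t * (gcoeff p q n * t ^ n))"
    by (rule ext, rule step)
  finally show ?thesis
    using suminf_mult[OF s[of t], of t] by (simp add: gseries_def)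
qed

text \<open>It suffices that the quadratic \<open>s^2 * U - 2 * s * P + V\<close> is positive at one
  suitable \<open>s\<close>. It is a series whose terms are nonnegative quadratics in
  \<open>s\<close>, because \<open>Gamma q / Gamma (n + q)\<close> is log-convex in
  \<open>q\<close>.\<close>

lemma gseries_Turan_strict:
  assumes p: "0 < p" and q: "0 < q" and t: "0 < t"
  shows "(Gamma (q + 1) * gseries p (q + 1) t)\<^sup>2
      < Gamma q * gseries p q t * (Gamma (q + 2) * gseries p (q + 2) t)"
proof -
  define u where "u n = gcoeff p (q + 1) n * t ^ n" for n
  define U where "U = Gamma q * gseries p q t"
  define P where "P = Gamma (q + 1) * gseries p (q + 1) t"
  define V where "V = Gamma (q + 2) * gseries p (q + 2) t"
  \<comment> \<open>The minimizer of the quadratic, where its value is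
    \<open>V - P^2 / U\<close>.\<close>
  define s where "s = P / U"
  have pos: "0 < u n" "0 < U" "0 < P" for n
    using assms gcoeff_pos gseries_pos by (auto simp: u_def U_def P_def)
  have "P < U"
    using gseries_normalized_less[of p q p "q + 1" t] p q t by (simp add: U_def P_def mult.assoc)
  then have s: "0 < s" "s < 1"
    using pos by (auto simp: s_def)
  have G: "Gamma (q + 1) = q * Gamma q" "Gamma (q + 2) = (q + 1) * Gamma (q + 1)"
    using Gamma_real_Suc[of q 0] Gamma_real_Suc[of "q + 1" 0] q by (simp_all add: add_ac)
  define d where "d n = s\<^sup>2 * (Gamma q * (gcoeff p q n * t ^ n)) - 2 * s * (Gamma (q + 1) * u n)
    + Gamma (q + 2) * (gcoeff p (q + 2) n * t ^ n)" for n
  have sums: "d sums (s\<^sup>2 * U - 2 * s * P + V)"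
    unfolding d_def U_def P_def V_def u_def gseries_def using p q
    by (intro sums_add sums_diff sums_mult summable_sums summable_gcoeff) auto
  have d: "d n = Gamma (q + 1) * u n * (s\<^sup>2 * ((real n + q) / q) - 2 * s + (q + 1) / (real n + q + 1))" for n
  proof -
    have 1: "Gamma q * (gcoeff p q n * t ^ n) = Gamma (q + 1) * u n * ((real n + q) / q)"
      using Gamma_real_Suc[OF q, of n] Gamma_real_nonzero[of q] q
      unfolding G by (simp add: u_def gcoeff_def add_ac)
    have 2: "Gamma (q + 2) * (gcoeff p (q + 2) n * t ^ n) = Gamma (q + 1) * u n * ((q + 1) / (real n + q + 1))"
      using Gamma_real_Suc[of "q + 1" n] q
      by (simp add: G u_def gcoeff_def add_ac mult_ac)
    show ?thesis
      unfolding d_def 1 2 by (simp add: algebra_simps)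
  qed
  have "0 \<le> d n" for n
  proof -
    \<comment> \<open>The outer coefficients of the bracket are at least \<open>b\<close> and equal
      to \<open>1 / b\<close>, so the bracket dominates the perfect square
      \<open>(b * s - 1)^2 / b\<close>.\<close>
    define b where "b = (real n + q + 1) / (q + 1)"
    have b: "0 < b" "b \<le> (real n + q) / q" "1 / b = (q + 1) / (real n + q + 1)"
      using q by (auto simp: b_def field_simps intro!: divide_pos_pos)
    have "0 \<le> (b * s - 1)\<^sup>2 / b"
      using b by simp
    also have "\<dots> = s\<^sup>2 * b - 2 * s + 1 / b"
      using b by (simp add: power2_eq_square field_simps)
    also have "\<dots> \<le> s\<^sup>2 * ((real n + q) / q) - 2 * s + (q + 1) / (real n + q + 1)"
      using mult_left_mono[OF b(2) zero_le_power2[of s]] b(3) by simp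
    finally show ?thesis
      using pos(1)[of n] pos(2) q unfolding d by (intro mult_nonneg_nonneg) auto
  qed
  \<comment> \<open>At \<open>n = 0\<close> the bracket is \<open>(s - 1)^2\<close>, which is
    positive because \<open>P < U\<close> strictly.\<close>
  moreover have "0 < d 0"
  proof -
    have "d 0 = Gamma (q + 1) * u 0 * (s - 1)\<^sup>2"
      using q by (simp add: d power2_eq_square algebra_simps)
    then show ?thesis
      using s pos(1)[of 0] q by simp
  qed
  ultimately have "0 < suminf d"
    using sums by (intro suminf_pos2[of _ 0]) (auto simp: sums_iff)
  then have "0 < (s\<^sup>2 * U - 2 * s * P + V) * U"
    using sums pos by (simp add: sums_iff)
  also have "\<dots> = U * V - P\<^sup>2"
    using pos by (simp add: s_def power2_eq_square field_simps)
  finally show ?thesis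
    by (simp add: U_def P_def V_def)
qed

subsection \<open>Modified Struve functions\<close>

lemma Gamma_three_halves: "Gamma (3/2 :: real) = sqrt pi / 2"
  using Gamma_real_Suc[of "1/2" 0] by (simp add: Gamma_one_half_real)

lemma powr_series_eq:
  assumes "0 < p" "0 < q" "0 < x"
  shows "(\<Sum>n. (x / 2) powr (2 * real n + r) / (Gamma (real n + p) * Gamma (real n + q)))
      = (x / 2) powr r * gseries p q ((x / 2)\<^sup>2)"
proof -
  have "(x / 2) powr (2 * real n) = ((x / 2)\<^sup>2) ^ n" for n
    using assms powr_realpow[of "x / 2" "2 * n"] by (simp add: power_mult)
  then have "(x / 2) powr (2 * real n + r) / (Gamma (real n + p) * Gamma (real n + q))
      = (x / 2) powr r * (gcoeff p q n * ((x / 2)\<^sup>2) ^ n)" for n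
    by (simp add: powr_add gcoeff_def)
  then show ?thesis
    using suminf_mult[OF summable_gcoeff[OF assms(1,2)]] by (simp add: gseries_def)
qed

lemma struve_L_eq:
  assumes "- 3/2 < \<nu>" "0 < x"
  shows "struve_L \<nu> x = (x / 2) powr (\<nu> + 1) * gseries (3/2) (\<nu> + 3/2) ((x / 2)\<^sup>2)"
  using powr_series_eq[of "3/2" "\<nu> + 3/2" x "\<nu> + 1"] assms by (simp add: struve_L_def add_ac)

lemma bessel_I_eq:
  assumes "- 2 < \<nu>" "0 < x"
  shows "bessel_I (\<nu> + 1) x = (x / 2) powr (\<nu> + 1) * gseries 1 (\<nu> + 2) ((x / 2)\<^sup>2)"
  using powr_series_eq[of 1 "\<nu> + 2" x "\<nu> + 1"] assms
  by (simp add: bessel_I_def Gamma_fact add_ac)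

lemma struve_L_pos: "- 3/2 < \<nu> \<Longrightarrow> 0 < x \<Longrightarrow> 0 < struve_L \<nu> x"
  by (simp add: struve_L_eq gseries_pos)

lemma bessel_struve_ratio:
  assumes "- 3/2 < \<nu>" "0 < x"
  shows "bessel_I (\<nu> + 1) x / struve_L \<nu> x
      = gseries 1 (\<nu> + 2) ((x / 2)\<^sup>2) / gseries (3/2) (\<nu> + 3/2) ((x / 2)\<^sup>2)"
  using assms by (simp add: struve_L_eq bessel_I_eq)

lemma struve_order_ratio:
  assumes "- 3/2 < \<nu>" "- 3/2 < \<mu>" "0 < x"
  shows "2 powr (\<nu> - \<mu>) * x powr (\<mu> - \<nu>) * struve_L \<nu> x / struve_L \<mu> x
      = gseries (3/2) (\<nu> + 3/2) ((x / 2)\<^sup>2) / gseries (3/2) (\<mu> + 3/2) ((x / 2)\<^sup>2)"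
  using assms by (simp add: struve_L_eq powr_divide powr_diff powr_add field_simps)

lemma struve_normalized:
  assumes "- 3/2 < \<nu>" "0 < x"
  shows "2 powr \<nu> * Gamma (\<nu> + 3/2) * x powr (- \<nu>) * struve_L \<nu> x
      = x / 2 * (Gamma (\<nu> + 3/2) * gseries (3/2) (\<nu> + 3/2) ((x / 2)\<^sup>2))"
  using assms by (simp add: struve_L_eq powr_divide powr_minus powr_add field_simps)

text \<open>The summand \<open>1 / sqrt pi\<close> is exactly the constant term missing from the
  shifted series, which explains its presence in (h).\<close>

lemma struve_normalized_Suc:
  assumes "- 3/2 < \<nu>" "0 < x"
  shows "1 / sqrt pi + 2 powr \<nu> * Gamma (\<nu> + 3/2) * x powr (- \<nu>) * struve_L (\<nu> + 1) x
      = Gamma (\<nu> + 3/2) * gseries (1/2) (\<nu> + 3/2) ((x / 2)\<^sup>2)"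
proof -
  have "2 powr \<nu> * x powr (- \<nu>) * struve_L (\<nu> + 1) x = (x / 2)\<^sup>2 * gseries (3/2) (\<nu> + 5/2) ((x / 2)\<^sup>2)"
    using assms by (simp add: struve_L_eq powr_divide powr_minus powr_add field_simps power2_eq_square)
  moreover have "Gamma (\<nu> + 3/2) * gcoeff (1/2) (\<nu> + 3/2) 0 = 1 / sqrt pi"
    using assms by (simp add: gcoeff_def Gamma_one_half_real Gamma_real_nonzero)
  ultimately show ?thesis
    using gseries_eq_mult[of "1/2" "\<nu> + 3/2" "(x / 2)\<^sup>2"] assms
    by (simp add: distrib_left add.commute[of "5/2"] mult_ac)
qed

text \<open>The power contributes \<open>\<nu> + 1\<close>; the series contributes twice its Euler
  operator because its argument is quadratic in \<open>x\<close>.\<close>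

lemma struve_log_deriv:
  assumes \<nu>: "- 3/2 < \<nu>" and x: "0 < x"
  shows "x * deriv (struve_L \<nu>) x = (x / 2) powr (\<nu> + 1) *
    ((\<nu> + 1) * gseries (3/2) (\<nu> + 3/2) ((x / 2)\<^sup>2)
      + 2 * (\<Sum>n. real n * gcoeff (3/2) (\<nu> + 3/2) n * ((x / 2)\<^sup>2) ^ n))"
proof -
  let ?G = "gseries (3/2) (\<nu> + 3/2)"
  obtain d where d: "(?G has_real_derivative d) (at ((x / 2)\<^sup>2))"
    and S1: "(x / 2)\<^sup>2 * d = (\<Sum>n. real n * gcoeff (3/2) (\<nu> + 3/2) n * ((x / 2)\<^sup>2) ^ n)"
    unfolding gseries_def
    by (rule DERIV_powser_mult[OF summable_gcoeff[of "3/2" "\<nu> + 3/2"], of "(x / 2)\<^sup>2"]) (use \<nu> in auto)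
  have "((\<lambda>x. (x / 2)\<^sup>2) has_real_derivative x / 2) (at x)"
    by (auto intro!: derivative_eq_intros)
  note G = DERIV_chain2[OF d this]
  have P: "((\<lambda>x. (x / 2) powr (\<nu> + 1)) has_real_derivative (\<nu> + 1) * (x / 2) powr \<nu> / 2) (at x)"
    using x by (auto intro!: derivative_eq_intros)
  have "((\<lambda>x. (x / 2) powr (\<nu> + 1) * ?G ((x / 2)\<^sup>2)) has_real_derivative
      (\<nu> + 1) * (x / 2) powr \<nu> / 2 * ?G ((x / 2)\<^sup>2) + d * (x / 2) * (x / 2) powr (\<nu> + 1)) (at x)"
    by (rule DERIV_mult[OF P G])
  \<comment> \<open>The product formula is available on the open half-line only, which is enough for
    the derivative at \<open>x\<close>.\<close>
  then have "(struve_L \<nu> has_real_derivative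
      (\<nu> + 1) * (x / 2) powr \<nu> / 2 * ?G ((x / 2)\<^sup>2) + d * (x / 2) * (x / 2) powr (\<nu> + 1)) (at x)"
    by (rule has_field_derivative_transform_within_open[where S = "{0<..}"]) (use \<nu> x in \<open>auto simp: struve_L_eq\<close>)
  then have "deriv (struve_L \<nu>) x
      = (\<nu> + 1) * (x / 2) powr \<nu> / 2 * ?G ((x / 2)\<^sup>2) + d * (x / 2) * (x / 2) powr (\<nu> + 1)"
    by (rule DERIV_imp_deriv)
  then show ?thesis
    using x unfolding S1[symmetric] by (simp add: powr_add power2_eq_square algebra_simps)
qed

text \<open>Shifting the index in the numerator gives both series the second parameter
  \<open>\<nu> + 3/2\<close> and separates two terms whose dependence on \<open>\<nu>\<close> is
  known.\<close>

lemma struve_quotient_eq: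
  assumes "- 3/2 < \<nu>" "0 < x"
  shows "struve_L (\<nu> + 1) x / struve_L \<nu> x
      = 2 / x * (gseries (1/2) (\<nu> + 3/2) ((x / 2)\<^sup>2) / gseries (3/2) (\<nu> + 3/2) ((x / 2)\<^sup>2)
        - 1 / (sqrt pi * (Gamma (\<nu> + 3/2) * gseries (3/2) (\<nu> + 3/2) ((x / 2)\<^sup>2))))"
proof -
  have "struve_L (\<nu> + 1) x / struve_L \<nu> x
      = 2 / x * ((x / 2)\<^sup>2 * gseries (3/2) (\<nu> + 5/2) ((x / 2)\<^sup>2) / gseries (3/2) (\<nu> + 3/2) ((x / 2)\<^sup>2))"
    using assms by (simp add: struve_L_eq powr_add power2_eq_square field_simps)
  also have "(x / 2)\<^sup>2 * gseries (3/2) (\<nu> + 5/2) ((x / 2)\<^sup>2)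
      = gseries (1/2) (\<nu> + 3/2) ((x / 2)\<^sup>2) - 1 / (sqrt pi * Gamma (\<nu> + 3/2))"
    using gseries_eq_mult[of "1/2" "\<nu> + 3/2" "(x / 2)\<^sup>2"] assms
    by (simp add: gcoeff_def Gamma_one_half_real add.commute[of "5/2"])
  finally show ?thesis
    by (simp add: diff_divide_distrib)
qed

text \<open>The first term of \<open>struve_quotient_eq\<close> decreases weakly in the order, while
  the subtracted reciprocal increases strictly; the strictness comes from the latter.\<close>

lemma struve_quotient_less:
  assumes "- 3/2 < \<nu>" "\<nu> < \<mu>" "0 < x"
  shows "struve_L (\<mu> + 1) x / struve_L \<mu> x < struve_L (\<nu> + 1) x / struve_L \<nu> x"
proof -
  let ?t = "(x / 2)\<^sup>2"
  have t: "0 < ?t"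
    using assms by simp
  have "gseries (1/2) (\<mu> + 3/2) ?t / gseries (3/2) (\<mu> + 3/2) ?t
      \<le> gseries (1/2) (\<nu> + 3/2) ?t / gseries (3/2) (\<nu> + 3/2) ?t"
    using gseries_shift_ratio_mono[of "1/2" "\<nu> + 3/2" "\<mu> + 3/2" ?t] assms t by simp
  moreover have "Gamma (\<mu> + 3/2) * gseries (3/2) (\<mu> + 3/2) ?t < Gamma (\<nu> + 3/2) * gseries (3/2) (\<nu> + 3/2) ?t"
    using gseries_normalized_less[of "3/2" "\<nu> + 3/2" "3/2" "\<mu> + 3/2" ?t] assms t
    by (simp add: mult.assoc)
  then have "1 / (sqrt pi * (Gamma (\<nu> + 3/2) * gseries (3/2) (\<nu> + 3/2) ?t))
      < 1 / (sqrt pi * (Gamma (\<mu> + 3/2) * gseries (3/2) (\<mu> + 3/2) ?t))"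
    using assms gseries_pos[of "3/2" "\<mu> + 3/2" ?t] gseries_pos[of "3/2" "\<nu> + 3/2" ?t]
    by (intro divide_strict_left_mono mult_strict_left_mono mult_pos_pos) auto
  ultimately show ?thesis
    unfolding struve_quotient_eq[OF assms(1,3)] struve_quotient_eq[OF less_trans[OF assms(1,2)] assms(3)]
    using assms by (intro mult_strict_left_mono) auto
qed

text \<open>The orders \<open>- 1/2\<close> and \<open>1/2\<close> have second parameters 1 and 2,
  where the series are hyperbolic functions.\<close>

lemma struve_quotient_minus_half:
  assumes "0 < x"
  shows "struve_L (1/2) x / struve_L (- 1/2) x = (cosh x - 1) / sinh x"
proof -
  have "struve_L (1/2) x / struve_L (- 1/2) x
      = ((x / 2)\<^sup>2 * gseries (3/2) 2 ((x / 2)\<^sup>2)) / (x / 2 * gseries (3/2) 1 ((x / 2)\<^sup>2))"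
    using assms powr_add[of "x / 2" "1/2" 1]
    by (simp add: struve_L_eq power2_eq_square divide_simps)
  then show ?thesis
    by (simp only: gseries_three_halves_1 gseries_three_halves_2) simp
qed

lemma struve_normalized_less:
  assumes "- 3/2 < \<nu>" "\<nu> < \<mu>" "0 < x"
  shows "2 powr \<mu> * Gamma (\<mu> + 3/2) * x powr (- \<mu>) * struve_L \<mu> x
      < 2 powr \<nu> * Gamma (\<nu> + 3/2) * x powr (- \<nu>) * struve_L \<nu> x"
proof -
  have "Gamma (\<mu> + 3/2) * gseries (3/2) (\<mu> + 3/2) ((x/2)\<^sup>2) < Gamma (\<nu> + 3/2) * gseries (3/2) (\<nu> + 3/2) ((x/2)\<^sup>2)"
    using gseries_normalized_less[of "3/2" "\<nu> + 3/2" "3/2" "\<mu> + 3/2" "(x/2)\<^sup>2"] assms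
    by (simp add: mult.assoc)
  then show ?thesis
    using assms by (simp add: struve_normalized)
qed

lemma struve_normalized_log_convex:
  assumes "0 < x"
  shows "log_convex_on {- 3/2<..} (\<lambda>\<nu>. 2 powr \<nu> * Gamma (\<nu> + 3/2) * x powr (- \<nu>) * struve_L \<nu> x)"
proof -
  let ?t = "(x / 2)\<^sup>2"
  have eq: "1 / Gamma (real n + 3/2) * ?t ^ n * (Gamma (\<nu> + 3/2) / Gamma (real n + (\<nu> + 3/2)))
      = Gamma (\<nu> + 3/2) * (gcoeff (3/2) (\<nu> + 3/2) n * ?t ^ n)" for n \<nu>
    by (simp add: gcoeff_def)
  \<comment> \<open>The endpoint is written \<open>- (3/2)\<close> to match \<open>- a\<close> with
    \<open>a = 3/2\<close>, since \<open>- 3/2\<close> parses as \<open>(- 3) / 2\<close>.\<close>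
  have "log_convex_on {- (3/2)<..} (\<lambda>\<nu>. \<Sum>n. 1 / Gamma (real n + 3/2) * ?t ^ n * (Gamma (\<nu> + 3/2) / Gamma (real n + (\<nu> + 3/2))))"
  proof (intro log_convex_on_suminf log_convex_on_mult[OF _ log_convex_on_Gamma_quotient])
    show "summable (\<lambda>n. 1 / Gamma (real n + 3/2) * ?t ^ n * (Gamma (\<nu> + 3/2) / Gamma (real n + (\<nu> + 3/2))))"
      if "\<nu> \<in> {- (3/2)<..}" for \<nu>
      unfolding eq using that by (intro summable_mult summable_gcoeff) auto
  qed (use assms in \<open>auto intro!: log_convex_on_const mult_pos_pos divide_pos_pos\<close>)
  then have "log_convex_on {- (3/2)<..} (\<lambda>\<nu>. x / 2 * (\<Sum>n. 1 / Gamma (real n + 3/2) * ?t ^ n * (Gamma (\<nu> + 3/2) / Gamma (real n + (\<nu> + 3/2)))))"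
    using assms by (intro log_convex_on_mult log_convex_on_const) auto
  then show ?thesis
    unfolding eq
    by (subst log_convex_on_cong[symmetric, of _ "\<lambda>\<nu>. x / 2 * (\<Sum>n. Gamma (\<nu> + 3/2) * (gcoeff (3/2) (\<nu> + 3/2) n * ?t ^ n))"])
      (use assms in \<open>simp_all add: struve_normalized gseries_def suminf_mult summable_gcoeff\<close>)
qed

text \<open>The function is \<open>\<nu> + 1\<close> plus twice the mean of \<open>n\<close>. This
  mean is a quotient of power series with coefficient quotient \<open>n\<close>, hence
  increasing.\<close>

lemma struve_log_deriv_mono:
  assumes "- 3/2 < \<nu>"
  shows "mono_on {0<..} (\<lambda>x. x * deriv (struve_L \<nu>) x / struve_L \<nu> x)"
proof (rule mono_onI)
  fix r s :: real assume rs: "r \<in> {0<..}" "s \<in> {0<..}" "r \<le> s"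
  let ?c = "gcoeff (3/2) (\<nu> + 3/2)" and ?G = "\<lambda>x. gseries (3/2) (\<nu> + 3/2) ((x / 2)\<^sup>2)"
  let ?S = "\<lambda>x. \<Sum>n. real n * ?c n * ((x / 2)\<^sup>2) ^ n"
  have c: "0 < ?c n" for n
    using assms by (auto intro!: gcoeff_pos)
  have sum: "summable (\<lambda>n. ?c n * x ^ n)" for x
    using assms by (intro summable_gcoeff) auto
  have eq: "x * deriv (struve_L \<nu>) x / struve_L \<nu> x = \<nu> + 1 + 2 * (?S x / ?G x)" if "0 < x" for x
    unfolding struve_log_deriv[OF assms that] struve_L_eq[OF assms that]
    using that assms gseries_pos[of "3/2" "\<nu> + 3/2" "(x/2)\<^sup>2"] by (simp add: field_simps)
  have inc: "incseq (\<lambda>n. real n * ?c n / ?c n)"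
    using less_imp_neq[OF c] by (simp add: incseq_def)
  have "?S r * ?G s \<le> ?S s * ?G r"
    unfolding gseries_def
    by (intro powser_ratio_mono inc summable_of_nat_mult sum c) (use rs in \<open>auto intro!: power_mono\<close>)
  then show "r * deriv (struve_L \<nu>) r / struve_L \<nu> r \<le> s * deriv (struve_L \<nu>) s / struve_L \<nu> s"
    using rs assms gseries_pos[of "3/2" "\<nu> + 3/2" "(r/2)\<^sup>2"] gseries_pos[of "3/2" "\<nu> + 3/2" "(s/2)\<^sup>2"]
    by (simp add: eq field_simps)
qed

text \<open>The lower bound says that the quotient of consecutive orders drops strictly from
  \<open>\<nu> - 1\<close> to \<open>\<nu>\<close>. The upper bound is the Turan inequality for the
  normalized series, with the Gamma factors converted.\<close>

lemma struve_Turan: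
  assumes \<nu>: "- 1/2 < \<nu>" and x: "0 < x"
  shows "0 < (struve_L \<nu> x)\<^sup>2 - struve_L (\<nu> - 1) x * struve_L (\<nu> + 1) x"
    and "(struve_L \<nu> x)\<^sup>2 - struve_L (\<nu> - 1) x * struve_L (\<nu> + 1) x < (struve_L \<nu> x)\<^sup>2 / (\<nu> + 3/2)"
proof -
  show "0 < (struve_L \<nu> x)\<^sup>2 - struve_L (\<nu> - 1) x * struve_L (\<nu> + 1) x"
    using struve_quotient_less[of "\<nu> - 1" \<nu> x] struve_L_pos[of \<nu> x] struve_L_pos[of "\<nu> - 1" x] assms
    by (simp add: field_simps power2_eq_square)
  \<comment> \<open>The second parameter belonging to order \<open>\<nu> - 1\<close>; it is positive
    exactly when \<open>\<nu> > - 1/2\<close>.\<close>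
  define q where "q = \<nu> + 1/2"
  define w where "w = (x / 2) powr (\<nu> + 1)"
  let ?t = "(x / 2)\<^sup>2"
  have q: "0 < q" "\<nu> - 1 + 3/2 = q" "\<nu> + 3/2 = q + 1" "\<nu> + 1 + 3/2 = q + 2"
    using \<nu> by (auto simp: q_def)
  have w: "0 < w"
    using x by (simp add: w_def)
  have G: "Gamma (q + 1) = q * Gamma q" "Gamma (q + 2) = (q + 1) * (q * Gamma q)"
    using Gamma_real_Suc[of q 0] Gamma_real_Suc[of "q + 1" 0] q by (simp_all add: add_ac)
  have L: "struve_L \<nu> x = w * gseries (3/2) (q + 1) ?t"
    using struve_L_eq[of \<nu> x] assms by (simp add: q w_def)
  have "(x / 2) powr \<nu> * (x / 2) powr (2 + \<nu>) = w\<^sup>2"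
    by (simp add: w_def power2_eq_square powr_add[symmetric])
  then have LL: "struve_L (\<nu> - 1) x * struve_L (\<nu> + 1) x = w\<^sup>2 * (gseries (3/2) q ?t * gseries (3/2) (q + 2) ?t)"
    using struve_L_eq[of "\<nu> - 1" x] struve_L_eq[of "\<nu> + 1" x] assms q
    by (simp add: mult_ac)
  have "(q * Gamma q)\<^sup>2 * (gseries (3/2) (q + 1) ?t)\<^sup>2
      < Gamma q * gseries (3/2) q ?t * ((q + 1) * (q * Gamma q) * gseries (3/2) (q + 2) ?t)"
    using gseries_Turan_strict[of "3/2" q ?t] q x by (simp add: G power_mult_distrib)
  then have "q * (Gamma q)\<^sup>2 * (q * (gseries (3/2) (q + 1) ?t)\<^sup>2)
      < q * (Gamma q)\<^sup>2 * ((q + 1) * (gseries (3/2) q ?t * gseries (3/2) (q + 2) ?t))"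
    by (simp add: power2_eq_square mult_ac)
  then have "q * (gseries (3/2) (q + 1) ?t)\<^sup>2 < (q + 1) * (gseries (3/2) q ?t * gseries (3/2) (q + 2) ?t)"
    using q by (simp add: mult_less_cancel_left_pos Gamma_real_nonzero)
  then have "w\<^sup>2 * (q * (gseries (3/2) (q + 1) ?t)\<^sup>2) < w\<^sup>2 * ((q + 1) * (gseries (3/2) q ?t * gseries (3/2) (q + 2) ?t))"
    using w by (intro mult_strict_left_mono) auto
  \<comment> \<open>The Gamma factors leave the ratio \<open>q / (q + 1)\<close>, and
    \<open>1 - q / (q + 1)\<close> is the required \<open>1 / (\<nu> + 3/2)\<close>.\<close>
  then have "q * (struve_L \<nu> x)\<^sup>2 < (q + 1) * (struve_L (\<nu> - 1) x * struve_L (\<nu> + 1) x)"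
    by (simp add: L LL power_mult_distrib mult_ac)
  then show "(struve_L \<nu> x)\<^sup>2 - struve_L (\<nu> - 1) x * struve_L (\<nu> + 1) x < (struve_L \<nu> x)\<^sup>2 / (\<nu> + 3/2)"
    using q(1) unfolding q(3) by (simp add: field_simps)
qed

text \<open>After multiplication by \<open>x^2\<close> the differential equation turns the
  expression into \<open>4 * w^2 * (S0 * S2 - S1^2)\<close>, which is positive as a
  variance.\<close>

lemma struve_deriv_bound:
  assumes \<nu>: "- 3/2 < \<nu>" and x: "0 < x"
  shows "0 < (1 + \<nu>\<^sup>2 / x\<^sup>2) * (struve_L \<nu> x)\<^sup>2 - (deriv (struve_L \<nu>) x)\<^sup>2
    + (\<nu> + 1/2) * x powr (\<nu> - 1) * struve_L \<nu> x / (sqrt pi * 2 powr (\<nu> - 1) * Gamma (\<nu> + 3/2))"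
    (is "0 < ?E")
proof -
  define w where "w = (x / 2) powr (\<nu> + 1)"
  define t where "t = (x / 2)\<^sup>2"
  let ?c = "gcoeff (3/2) (\<nu> + 3/2)"
  define S0 where "S0 = gseries (3/2) (\<nu> + 3/2) t"
  define S1 where "S1 = (\<Sum>n. real n * ?c n * t ^ n)"
  define S2 where "S2 = (\<Sum>n. real n * (real n * ?c n) * t ^ n)"
  define K where "K = ?c 0"
  have w: "0 < w" and t: "0 < t" and xt: "x\<^sup>2 = 4 * t"
    using x by (auto simp: w_def t_def power2_eq_square)
  have ineq: "S1\<^sup>2 < S0 * S2"
    unfolding S0_def S1_def S2_def gseries_def using \<nu> t
    by (intro powser_moment_strict summable_gcoeff gcoeff_pos) auto
  have ode: "S2 + (\<nu> + 1) * S1 + (2 * \<nu> + 1) / 4 * S0 = t * S0 + (2 * \<nu> + 1) / 4 * K"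
    using gseries_ODE[of "3/2" "\<nu> + 3/2" t] \<nu> by (simp add: S0_def S1_def S2_def K_def field_simps)
  have L: "struve_L \<nu> x = w * S0"
    using struve_L_eq[OF assms] by (simp add: w_def S0_def t_def)
  have D: "x * deriv (struve_L \<nu>) x = w * ((\<nu> + 1) * S0 + 2 * S1)"
    using struve_log_deriv[OF assms] by (simp add: w_def S0_def S1_def t_def)
  have K: "K = 2 / (sqrt pi * Gamma (\<nu> + 3/2))"
    by (simp add: K_def gcoeff_def Gamma_three_halves)
  \<comment> \<open>The last summand of the expression is matched with the inhomogeneous constant
    \<open>K\<close> of the differential equation.\<close>
  have "x\<^sup>2 * (x powr (\<nu> - 1) / 2 powr (\<nu> - 1)) = 4 * w"
    using x by (simp add: w_def powr_divide powr_add powr_diff power2_eq_square)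
  then have "x\<^sup>2 * (x powr (\<nu> - 1) / 2 powr (\<nu> - 1)) * ((\<nu> + 1/2) * (w * S0 / (sqrt pi * Gamma (\<nu> + 3/2))))
      = w\<^sup>2 * ((2 * \<nu> + 1) * K * S0)"
    unfolding K by (simp add: power2_eq_square algebra_simps add_divide_distrib)
  then have T: "x\<^sup>2 * ((\<nu> + 1/2) * x powr (\<nu> - 1) * struve_L \<nu> x / (sqrt pi * 2 powr (\<nu> - 1) * Gamma (\<nu> + 3/2)))
      = w\<^sup>2 * ((2 * \<nu> + 1) * K * S0)"
    by (simp add: L mult_ac)
  have "x\<^sup>2 * ?E = (x\<^sup>2 + \<nu>\<^sup>2) * (struve_L \<nu> x)\<^sup>2 - (x * deriv (struve_L \<nu>) x)\<^sup>2
    + x\<^sup>2 * ((\<nu> + 1/2) * x powr (\<nu> - 1) * struve_L \<nu> x / (sqrt pi * 2 powr (\<nu> - 1) * Gamma (\<nu> + 3/2)))"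
    using x by (simp add: field_simps)
  also have "\<dots> = w\<^sup>2 * ((4 * t + \<nu>\<^sup>2) * S0\<^sup>2 - ((\<nu> + 1) * S0 + 2 * S1)\<^sup>2 + (2 * \<nu> + 1) * K * S0)"
    unfolding T unfolding D L xt power_mult_distrib by (simp add: algebra_simps)
  also have "(4 * t + \<nu>\<^sup>2) * S0\<^sup>2 - ((\<nu> + 1) * S0 + 2 * S1)\<^sup>2 + (2 * \<nu> + 1) * K * S0
      = 4 * S0 * (t * S0 + (2 * \<nu> + 1) / 4 * K) + \<nu>\<^sup>2 * S0\<^sup>2 - ((\<nu> + 1) * S0 + 2 * S1)\<^sup>2"
    by (simp add: power2_eq_square algebra_simps)
  also have "\<dots> = 4 * (S0 * S2 - S1\<^sup>2)"
    unfolding ode[symmetric] by (simp add: power2_eq_square algebra_simps)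
  finally have "0 < x\<^sup>2 * ?E"
    using ineq w by simp
  then show ?thesis
    using x by (simp add: zero_less_mult_iff)
qed

section \<open>Comparison of Struve and Bessel functions\<close>

lemma struve_less_bessel:
  assumes "- 1/2 < \<nu>" "0 < x"
  shows "struve_L \<nu> x < 2 * Gamma (\<nu> + 2) / (sqrt pi * Gamma (\<nu> + 3/2)) * bessel_I (\<nu> + 1) x"
proof -
  \<comment> \<open>The difference
    \<open>(n + 3/2) * (n + \<nu> + 3/2) - (n + 1) * (n + \<nu> + 2)\<close> is
    \<open>(2 * \<nu> + 1) / 4\<close> for every \<open>n\<close>, so its sign changes at
    \<open>\<nu> = - 1/2\<close>.\<close>
  have "Gamma (3/2) * Gamma (\<nu> + 3/2) * gseries (3/2) (\<nu> + 3/2) ((x / 2)\<^sup>2)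
      < Gamma 1 * Gamma (\<nu> + 2) * gseries 1 (\<nu> + 2) ((x / 2)\<^sup>2)"
    using assms by (intro gseries_normalized_less) (auto simp: algebra_simps)
  then have "gseries (3/2) (\<nu> + 3/2) ((x / 2)\<^sup>2)
      < 2 * Gamma (\<nu> + 2) / (sqrt pi * Gamma (\<nu> + 3/2)) * gseries 1 (\<nu> + 2) ((x / 2)\<^sup>2)"
    using assms by (simp add: Gamma_three_halves pos_less_divide_eq mult_ac)
  from mult_strict_left_mono[OF this, of "(x / 2) powr (\<nu> + 1)"] show ?thesis
    using assms by (simp add: struve_L_eq bessel_I_eq mult_ac)
qed

lemma struve_greater_bessel:
  assumes "- 3/2 < \<nu>" "\<nu> < - 1/2" "0 < x"
  shows "2 * Gamma (\<nu> + 2) / (sqrt pi * Gamma (\<nu> + 3/2)) * bessel_I (\<nu> + 1) x < struve_L \<nu> x"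
proof -
  have "Gamma 1 * Gamma (\<nu> + 2) * gseries 1 (\<nu> + 2) ((x / 2)\<^sup>2)
      < Gamma (3/2) * Gamma (\<nu> + 3/2) * gseries (3/2) (\<nu> + 3/2) ((x / 2)\<^sup>2)"
    using assms by (intro gseries_normalized_less) (auto simp: algebra_simps)
  then have "2 * Gamma (\<nu> + 2) / (sqrt pi * Gamma (\<nu> + 3/2)) * gseries 1 (\<nu> + 2) ((x / 2)\<^sup>2)
      < gseries (3/2) (\<nu> + 3/2) ((x / 2)\<^sup>2)"
    using assms by (simp add: Gamma_three_halves pos_divide_less_eq mult_ac)
  from mult_strict_left_mono[OF this, of "(x / 2) powr (\<nu> + 1)"] show ?thesis
    using assms by (simp add: struve_L_eq bessel_I_eq mult_ac)
qed

text \<open>At order \<open>- 1/2\<close> the parameter pairs are \<open>(3/2, 1)\<close> and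
  \<open>(1, 3/2)\<close>, and the series is symmetric in them.\<close>

lemma struve_eq_bessel:
  assumes "0 < x"
  shows "struve_L (- 1/2) x = 2 * Gamma (- 1/2 + 2) / (sqrt pi * Gamma (- 1/2 + 3/2)) * bessel_I (- 1/2 + 1) x"
proof -
  have "gseries (3/2) 1 ((x / 2)\<^sup>2) = gseries 1 (3/2) ((x / 2)\<^sup>2)"
    by (simp add: gseries_def gcoeff_def mult.commute)
  then show ?thesis
    using assms struve_L_eq[of "- 1/2" x] bessel_I_eq[of "- 1/2" x] by (simp add: Gamma_three_halves)
qed

section \<open>Monotonicity in the argument and the log-convexity in (h)\<close>

lemma bessel_struve_ratio_mono:
  assumes "- 1/2 \<le> \<nu>"
  shows "mono_on {0<..} (\<lambda>x. bessel_I (\<nu> + 1) x / struve_L \<nu> x)"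
proof (rule mono_onI)
  fix r s :: real assume *: "r \<in> {0<..}" "s \<in> {0<..}" "r \<le> s"
  have "gseries 1 (\<nu> + 2) ((r/2)\<^sup>2) / gseries (3/2) (\<nu> + 3/2) ((r/2)\<^sup>2)
      \<le> gseries 1 (\<nu> + 2) ((s/2)\<^sup>2) / gseries (3/2) (\<nu> + 3/2) ((s/2)\<^sup>2)"
    using assms * by (intro gseries_ratio_mono) (auto simp: algebra_simps intro!: power_mono)
  then show "bessel_I (\<nu> + 1) r / struve_L \<nu> r \<le> bessel_I (\<nu> + 1) s / struve_L \<nu> s"
    using assms * by (simp add: bessel_struve_ratio)
qed

lemma bessel_struve_ratio_antimono:
  assumes "- 3/2 < \<nu>" "\<nu> \<le> - 1/2"
  shows "antimono_on {0<..} (\<lambda>x. bessel_I (\<nu> + 1) x / struve_L \<nu> x)"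
proof (rule monotone_onI)
  fix r s :: real assume *: "r \<in> {0<..}" "s \<in> {0<..}" "r \<le> s"
  \<comment> \<open>In this range the quadratics compare in the opposite direction, so the
    reciprocal quotient is the increasing one.\<close>
  have "gseries (3/2) (\<nu> + 3/2) ((r/2)\<^sup>2) / gseries 1 (\<nu> + 2) ((r/2)\<^sup>2)
      \<le> gseries (3/2) (\<nu> + 3/2) ((s/2)\<^sup>2) / gseries 1 (\<nu> + 2) ((s/2)\<^sup>2)"
    using assms * by (intro gseries_ratio_mono) (auto simp: algebra_simps intro!: power_mono)
  then have "gseries 1 (\<nu> + 2) ((s/2)\<^sup>2) / gseries (3/2) (\<nu> + 3/2) ((s/2)\<^sup>2)
      \<le> gseries 1 (\<nu> + 2) ((r/2)\<^sup>2) / gseries (3/2) (\<nu> + 3/2) ((r/2)\<^sup>2)"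
    using assms * gseries_pos[of 1 "\<nu> + 2"] gseries_pos[of "3/2" "\<nu> + 3/2"]
    by (simp add: field_simps)
  then show "bessel_I (\<nu> + 1) s / struve_L \<nu> s \<le> bessel_I (\<nu> + 1) r / struve_L \<nu> r"
    using assms * by (simp add: bessel_struve_ratio)
qed

lemma struve_order_ratio_mono:
  assumes "\<nu> \<le> \<mu>" "- 3/2 < \<nu>"
  shows "mono_on {0<..} (\<lambda>x. 2 powr (\<nu> - \<mu>) * x powr (\<mu> - \<nu>) * struve_L \<nu> x / struve_L \<mu> x)"
proof (rule mono_onI)
  fix r s :: real assume *: "r \<in> {0<..}" "s \<in> {0<..}" "r \<le> s"
  have "gseries (3/2) (\<nu> + 3/2) ((r/2)\<^sup>2) / gseries (3/2) (\<mu> + 3/2) ((r/2)\<^sup>2)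
      \<le> gseries (3/2) (\<nu> + 3/2) ((s/2)\<^sup>2) / gseries (3/2) (\<mu> + 3/2) ((s/2)\<^sup>2)"
    using assms * by (intro gseries_ratio_mono) (auto intro!: power_mono mult_left_mono)
  then show "2 powr (\<nu> - \<mu>) * r powr (\<mu> - \<nu>) * struve_L \<nu> r / struve_L \<mu> r
      \<le> 2 powr (\<nu> - \<mu>) * s powr (\<mu> - \<nu>) * struve_L \<nu> s / struve_L \<mu> s"
    using assms * by (simp add: struve_order_ratio)
qed

lemma struve_order_ratio_antimono:
  assumes "\<mu> \<le> \<nu>" "- 3/2 < \<mu>"
  shows "antimono_on {0<..} (\<lambda>x. 2 powr (\<nu> - \<mu>) * x powr (\<mu> - \<nu>) * struve_L \<nu> x / struve_L \<mu> x)"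
proof (rule monotone_onI)
  fix r s :: real assume *: "r \<in> {0<..}" "s \<in> {0<..}" "r \<le> s"
  have "gseries (3/2) (\<mu> + 3/2) ((r/2)\<^sup>2) / gseries (3/2) (\<nu> + 3/2) ((r/2)\<^sup>2)
      \<le> gseries (3/2) (\<mu> + 3/2) ((s/2)\<^sup>2) / gseries (3/2) (\<nu> + 3/2) ((s/2)\<^sup>2)"
    using assms * by (intro gseries_ratio_mono) (auto intro!: power_mono mult_left_mono)
  then have "gseries (3/2) (\<nu> + 3/2) ((s/2)\<^sup>2) / gseries (3/2) (\<mu> + 3/2) ((s/2)\<^sup>2)
      \<le> gseries (3/2) (\<nu> + 3/2) ((r/2)\<^sup>2) / gseries (3/2) (\<mu> + 3/2) ((r/2)\<^sup>2)"
    using assms * gseries_pos[of "3/2" "\<mu> + 3/2"] gseries_pos[of "3/2" "\<nu> + 3/2"]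
    by (simp add: field_simps)
  then show "2 powr (\<nu> - \<mu>) * s powr (\<mu> - \<nu>) * struve_L \<nu> s / struve_L \<mu> s
      \<le> 2 powr (\<nu> - \<mu>) * r powr (\<mu> - \<nu>) * struve_L \<nu> r / struve_L \<mu> r"
    using assms * by (simp add: struve_order_ratio)
qed

lemma struve_normalized_Suc_log_convex:
  assumes "- 1/2 \<le> \<nu>"
  shows "log_convex_on {0<..}
    (\<lambda>x. 1 / sqrt pi + 2 powr \<nu> * Gamma (\<nu> + 3/2) * x powr (- \<nu>) * struve_L (\<nu> + 1) x)"
proof -
  have "log_convex_on {0<..} (\<lambda>x. Gamma (\<nu> + 3/2) * gseries (1/2) (\<nu> + 3/2) ((x / 2)\<^sup>2))"
    using assms by (intro log_convex_on_mult log_convex_on_const log_convex_on_gseries_half) auto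
  then show ?thesis
    by (rule log_convex_on_cong[THEN iffD1, rotated]) (use assms in \<open>simp add: struve_normalized_Suc\<close>)
qed

theorem theorem1:
  "(\<forall>\<nu>::real. \<nu> \<ge> - 1/2 \<longrightarrow>
      mono_on {0<..} (\<lambda>x. bessel_I (\<nu> + 1) x / struve_L \<nu> x))
 \<and> (\<forall>\<nu>::real. - 3/2 < \<nu> \<and> \<nu> \<le> - 1/2 \<longrightarrow>
      antimono_on {0<..} (\<lambda>x. bessel_I (\<nu> + 1) x / struve_L \<nu> x))
 \<and> (\<forall>\<mu> \<nu>::real. \<mu> \<ge> \<nu> \<and> \<nu> > - 3/2 \<longrightarrow>
      mono_on {0<..} (\<lambda>x. 2 powr (\<nu> - \<mu>) * x powr (\<mu> - \<nu>) * struve_L \<nu> x / struve_L \<mu> x))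
 \<and> (\<forall>\<mu> \<nu>::real. \<nu> \<ge> \<mu> \<and> \<mu> > - 3/2 \<longrightarrow>
      antimono_on {0<..} (\<lambda>x. 2 powr (\<nu> - \<mu>) * x powr (\<mu> - \<nu>) * struve_L \<nu> x / struve_L \<mu> x))
 \<and> (\<forall>x::real. x > 0 \<longrightarrow>
      antimono_on {- 3/2<..} (\<lambda>\<nu>. 2 powr \<nu> * Gamma (\<nu> + 3/2) * x powr (- \<nu>) * struve_L \<nu> x)
    \<and> log_convex_on {- 3/2<..} (\<lambda>\<nu>. 2 powr \<nu> * Gamma (\<nu> + 3/2) * x powr (- \<nu>) * struve_L \<nu> x))
 \<and> (\<forall>x::real. x > 0 \<longrightarrow>
      antimono_on {- 3/2<..} (\<lambda>\<nu>. struve_L (\<nu> + 1) x / struve_L \<nu> x))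
 \<and> (\<forall>\<nu>::real. \<nu> > - 3/2 \<longrightarrow>
      mono_on {0<..} (\<lambda>x. x * deriv (struve_L \<nu>) x / struve_L \<nu> x))
 \<and> (\<forall>\<nu>::real. \<nu> \<ge> - 1/2 \<longrightarrow>
      log_convex_on {0<..}
        (\<lambda>x. 1 / sqrt pi + 2 powr \<nu> * Gamma (\<nu> + 3/2) * x powr (- \<nu>) * struve_L (\<nu> + 1) x))
 \<and> (\<forall>x::real. x > 0 \<longrightarrow>
      (\<forall>\<nu>. \<nu> > - 1/2 \<longrightarrow>
         struve_L \<nu> x < 2 * Gamma (\<nu> + 2) / (sqrt pi * Gamma (\<nu> + 3/2)) * bessel_I (\<nu> + 1) x)
    \<and> (\<forall>\<mu> \<nu>. \<mu> > \<nu> \<and> \<nu> > - 3/2 \<longrightarrow>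
         2 powr \<nu> * Gamma (\<nu> + 3/2) * x powr (- \<nu>) * struve_L \<nu> x
           > 2 powr \<mu> * Gamma (\<mu> + 3/2) * x powr (- \<mu>) * struve_L \<mu> x)
    \<and> (\<forall>\<nu>. \<nu> > - 1/2 \<longrightarrow>
         0 < (struve_L \<nu> x)\<^sup>2 - struve_L (\<nu> - 1) x * struve_L (\<nu> + 1) x
       \<and> (struve_L \<nu> x)\<^sup>2 - struve_L (\<nu> - 1) x * struve_L (\<nu> + 1) x
           < (struve_L \<nu> x)\<^sup>2 / (\<nu> + 3/2))
    \<and> (\<forall>\<nu>. \<nu> > - 1/2 \<longrightarrow>
         struve_L (\<nu> + 1) x / struve_L \<nu> x < (cosh x - 1) / sinh x
       \<and> (cosh x - 1) / sinh x < 1)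
    \<and> (\<forall>\<nu>. \<nu> > - 3/2 \<longrightarrow>
         (1 + \<nu>\<^sup>2 / x\<^sup>2) * (struve_L \<nu> x)\<^sup>2 - (deriv (struve_L \<nu>) x)\<^sup>2
           + (\<nu> + 1/2) * x powr (\<nu> - 1) * struve_L \<nu> x
             / (sqrt pi * 2 powr (\<nu> - 1) * Gamma (\<nu> + 3/2)) > 0)
    \<and> (\<forall>\<nu>. - 3/2 < \<nu> \<and> \<nu> < - 1/2 \<longrightarrow>
         struve_L \<nu> x > 2 * Gamma (\<nu> + 2) / (sqrt pi * Gamma (\<nu> + 3/2)) * bessel_I (\<nu> + 1) x
       \<and> struve_L (\<nu> + 1) x / struve_L \<nu> x > (cosh x - 1) / sinh x)
    \<and> (\<forall>\<mu> \<nu>. \<nu> > \<mu> \<and> \<mu> > - 3/2 \<longrightarrow>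
         2 powr \<nu> * Gamma (\<nu> + 3/2) * x powr (- \<nu>) * struve_L \<nu> x
           < 2 powr \<mu> * Gamma (\<mu> + 3/2) * x powr (- \<mu>) * struve_L \<mu> x)
    \<and> (\<forall>\<nu>. \<nu> = - 1/2 \<longrightarrow>
         struve_L \<nu> x = 2 * Gamma (\<nu> + 2) / (sqrt pi * Gamma (\<nu> + 3/2)) * bessel_I (\<nu> + 1) x
       \<and> struve_L (\<nu> + 1) x / struve_L \<nu> x = (cosh x - 1) / sinh x)
    \<and> (\<forall>\<mu> \<nu>. \<mu> = \<nu> \<longrightarrow>
         2 powr \<nu> * Gamma (\<nu> + 3/2) * x powr (- \<nu>) * struve_L \<nu> x
           = 2 powr \<mu> * Gamma (\<mu> + 3/2) * x powr (- \<mu>) * struve_L \<mu> x))"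
proof (intro conjI allI impI)
  fix x :: real assume x: "0 < x"
  show "antimono_on {- 3/2<..} (\<lambda>\<nu>. 2 powr \<nu> * Gamma (\<nu> + 3/2) * x powr (- \<nu>) * struve_L \<nu> x)"
  proof (rule monotone_onI)
    fix \<nu> \<mu> :: real assume "\<nu> \<in> {- 3/2<..}" "\<nu> \<le> \<mu>"
    then show "2 powr \<mu> * Gamma (\<mu> + 3/2) * x powr (- \<mu>) * struve_L \<mu> x
        \<le> 2 powr \<nu> * Gamma (\<nu> + 3/2) * x powr (- \<nu>) * struve_L \<nu> x"
      using struve_normalized_less[of \<nu> \<mu> x] x by (cases "\<nu> = \<mu>") auto
  qed
  show "antimono_on {- 3/2<..} (\<lambda>\<nu>. struve_L (\<nu> + 1) x / struve_L \<nu> x)"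
  proof (rule monotone_onI)
    fix \<nu> \<mu> :: real assume "\<nu> \<in> {- 3/2<..}" "\<nu> \<le> \<mu>"
    then show "struve_L (\<mu> + 1) x / struve_L \<mu> x \<le> struve_L (\<nu> + 1) x / struve_L \<nu> x"
      using struve_quotient_less[of \<nu> \<mu> x] x by (cases "\<nu> = \<mu>") auto
  qed
  show "log_convex_on {- 3/2<..} (\<lambda>\<nu>. 2 powr \<nu> * Gamma (\<nu> + 3/2) * x powr (- \<nu>) * struve_L \<nu> x)"
    by (rule struve_normalized_log_convex[OF x])
  \<comment> \<open>The difference \<open>cosh x - sinh x\<close> is \<open>exp (- x)\<close>, which
    is below 1.\<close>
  have "cosh x - 1 < sinh x"
    using cosh_minus_sinh[of x] x by (smt (verit) exp_less_one_iff)
  then show "(cosh x - 1) / sinh x < 1"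
    using x by simp
  fix \<nu> :: real
  \<comment> \<open>The hyperbolic bound is the value of the quotient at order \<open>- 1/2\<close>,
    so strict monotonicity in the order decides both sides.\<close>
  show "struve_L (\<nu> + 1) x / struve_L \<nu> x < (cosh x - 1) / sinh x" if "- 1/2 < \<nu>"
    using struve_quotient_less[of "- 1/2" \<nu> x] struve_quotient_minus_half[OF x] that x by simp
  show "(cosh x - 1) / sinh x < struve_L (\<nu> + 1) x / struve_L \<nu> x" if "- 3/2 < \<nu> \<and> \<nu> < - 1/2"
    using struve_quotient_less[of \<nu> "- 1/2" x] struve_quotient_minus_half[OF x] that x by simp
  show "struve_L (\<nu> + 1) x / struve_L \<nu> x = (cosh x - 1) / sinh x" if "\<nu> = - 1/2"
    using struve_quotient_minus_half[OF x] that by simp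
  show "struve_L \<nu> x = 2 * Gamma (\<nu> + 2) / (sqrt pi * Gamma (\<nu> + 3/2)) * bessel_I (\<nu> + 1) x" if "\<nu> = - 1/2"
    unfolding that by (rule struve_eq_bessel[OF x])
  show "struve_L \<nu> x < 2 * Gamma (\<nu> + 2) / (sqrt pi * Gamma (\<nu> + 3/2)) * bessel_I (\<nu> + 1) x" if "- 1/2 < \<nu>"
    by (rule struve_less_bessel[OF that x])
  show "2 * Gamma (\<nu> + 2) / (sqrt pi * Gamma (\<nu> + 3/2)) * bessel_I (\<nu> + 1) x < struve_L \<nu> x"
    if "- 3/2 < \<nu> \<and> \<nu> < - 1/2"
    using struve_greater_bessel[of \<nu> x] that x by blast
  show "0 < (struve_L \<nu> x)\<^sup>2 - struve_L (\<nu> - 1) x * struve_L (\<nu> + 1) x" if "- 1/2 < \<nu>"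
    by (rule struve_Turan[OF that x])
qed (auto intro!: bessel_struve_ratio_mono bessel_struve_ratio_antimono struve_order_ratio_mono
    struve_order_ratio_antimono struve_log_deriv_mono struve_normalized_Suc_log_convex
    struve_normalized_less struve_Turan struve_deriv_bound)

end
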